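(* In the setting described in the context (spaces $V\hookrightarrow H\hookrightarrow V'$, $\alpha\in[0,1[$, damping $\gamma$, operator $A$, nonlinearity $f=\nabla F$, convex function $\Phi$, and source $g\in L^1(\mathbb{R}^+,H)$), assume that the interior of the set $\arg\min\Phi$ with respect to the strong topology of $V$ is not empty. Let $u\in W^{2,1}_{loc}(\mathbb{R}^+,H)\cap W^{1,1}_{loc}(\mathbb{R}^+,V)$ be a solution of $$u''(t)+\gamma(t)u'(t)+Au(t)+f(u(t))=g(t),\quad t\ge 0.$$ If $\int_0^{+\infty}(1+t)^{\alpha}|g(t)|\,dt<\infty$ and $u\in L^\infty(\mathbb{R}^+,H)$, then $u(t)$ converges strongly in $V$ as $t\to+\infty$ to some element of $\arg\min\Phi$.
   Context: Setting. $\mathbb{R}^+=[0,+\infty)$. $H$ is a real Hilbert space with inner product $\langle\cdot,\cdot\rangle$ and norm $|\cdot|$. $V$ is another Hilbert space, with norm $\|\cdot\|_V$, continuously and densely embedded in $H$; $V'$ is the dual of $V$. Identifying $H$ with its dual, $V\hookrightarrow H\hookrightarrow V'$, and $\langle v,w\rangle_{V',V}=\langle v,w\rangle$ for all $(v,w)\in H\times V$. Damping: $\alpha\in[0,1[$, and $\gamma\in W^{1,1}_{loc}(\mathbb{R}^+,\mathbb{R}^+)$ is such that there exist $K>0$ and $t_0\ge0$ with $\gamma(t)\ge \frac{K}{(1+t)^\alpha}$ for all $t\ge t_0$, and $\big((1+t)^\alpha\gamma(t)\big)'\le 0$ for a.e. $t\ge t_0$. Operator: $A:V\to V'$ is linear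 and continuous; the bilinear form $a(v,w)=\langle Av,w\rangle_{V',V}$ on $V\times V$ is symmetric, positive ($a(v,v)\ge0$ for all $v\in V$), and there exist $\lambda\ge0$, $\mu>0$ with $a(v,v)+\lambda|v|^2\ge\mu\|v\|_V^2$ for all $v\in V$. Nonlinearity: $f:V\to V'$ is continuous and there is a $C^1$ convex function $F:V\to\mathbb{R}$ with $F'(u)(v)=\langle f(u),v\rangle_{V',V}$ for all $u,v\in V$. Potential: $\Phi:V\to\mathbb{R}$, $\Phi(v)=\frac12 a(v,v)+F(v)$; it is a $C^1$ convex function with $\nabla\Phi(v)=Av+f(v)$. The set of minimizers is $\arg\min\Phi=\{v\in V:\Phi(v)=\min_V\Phi\}=\{v\in V: Av+f(v)=0\}$ (assumed nonempty). Source: $g\in L^1(\mathbb{R}^+,H)$. The equation is understood to hold for almost every $t\ge0$. *)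

theory Defs
  imports "HOL-Analysis.Analysis"
begin

text \<open>
  The library's Bochner integral is restricted to second countable target spaces, whereas the
  Hilbert spaces here need not be separable.  Strong measurability and Bochner integrability on
  \<open>S\<close> are therefore spelled out.
\<close>

definition strongly_measurable_on :: "real set \<Rightarrow> (real \<Rightarrow> 'a::real_normed_vector) \<Rightarrow> bool" where
  "strongly_measurable_on S f \<longleftrightarrow>
     (\<exists>s. (\<forall>n::nat. simple_function (lebesgue_on S) (s n)) \<and>
          (AE t in lebesgue_on S. (\<lambda>n. s n t) \<longlonglongrightarrow> f t))"

definition L1_on :: "real set \<Rightarrow> (real \<Rightarrow> 'a::real_normed_vector) \<Rightarrow> bool" where
  "L1_on S f \<longleftrightarrow> strongly_measurable_on S f \<and> integrable (lebesgue_on S) (\<lambda>t. norm (f t))"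

definition Linfty_on :: "real set \<Rightarrow> (real \<Rightarrow> 'a::real_normed_vector) \<Rightarrow> bool" where
  "Linfty_on S f \<longleftrightarrow>
     strongly_measurable_on S f \<and> (\<exists>C. AE t in lebesgue_on S. norm (f t) \<le> C)"

text \<open>
  Functions on the half-line \<open>[0, \<infinity>)\<close> are functions on \<open>real\<close> whose values at negative arguments
  are never used; ``locally'' means on every compact interval \<open>[0, T]\<close>.
\<close>

definition L1_loc :: "(real \<Rightarrow> 'a::real_normed_vector) \<Rightarrow> bool" where
  "L1_loc f \<longleftrightarrow> (\<forall>T\<ge>0. L1_on {0..T} f)"

text \<open>
  \<open>W11_loc_deriv u u'\<close>: \<open>u\<close> is (the continuous representative of) an element of
  \<open>W^{1,1}_loc([0, \<infinity>), X)\<close> with weak derivative \<open>u'\<close>, that is, \<open>u'\<close> is locally Bochner integrable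
  and \<open>u(t) = u(0) + \<integral>_0^t u'\<close>.  For a Bochner integrable function into a Banach space the
  gauge integral \<open>has_integral\<close> exists and coincides with the Bochner integral.
\<close>

definition W11_loc_deriv ::
    "(real \<Rightarrow> 'a::real_normed_vector) \<Rightarrow> (real \<Rightarrow> 'a) \<Rightarrow> bool" where
  "W11_loc_deriv u u' \<longleftrightarrow> L1_loc u' \<and> (\<forall>t\<ge>0. (u' has_integral (u t - u 0)) {0..t})"

definition W11_loc :: "(real \<Rightarrow> 'a::real_normed_vector) \<Rightarrow> bool" where
  "W11_loc u \<longleftrightarrow> (\<exists>u'. W11_loc_deriv u u')"

text \<open>
  The dual \<open>V'\<close> of \<open>V\<close> is \<open>'v \<Rightarrow>\<^sub>L real\<close>.  For the embedding \<open>\<iota>\<close> of \<open>V\<close> into \<open>H\<close>, the embedding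
  of \<open>H\<close> into \<open>V'\<close> sends \<open>h\<close> to the functional \<open>w \<mapsto> \<langle>h, \<iota> w\<rangle>\<close>.
\<close>

definition dual_emb ::
    "('v::real_normed_vector \<Rightarrow>\<^sub>L 'h::real_inner) \<Rightarrow> 'h \<Rightarrow> ('v \<Rightarrow>\<^sub>L real)" where
  "dual_emb \<iota> h = blinfun_inner_right h o\<^sub>L \<iota>"

definition potential ::
    "('v::real_normed_vector \<Rightarrow>\<^sub>L ('v \<Rightarrow>\<^sub>L real)) \<Rightarrow> ('v \<Rightarrow> real) \<Rightarrow> 'v \<Rightarrow> real" where
  "potential A F v = 1/2 * A v v + F v"

definition argmin_set :: "('v \<Rightarrow> real) \<Rightarrow> 'v set" where
  "argmin_set \<Phi> = {v. is_arg_min \<Phi> (\<lambda>_. True) v}"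

lemma dual_emb_apply: "dual_emb \<iota> h w = h \<bullet> \<iota> w"
  by (simp add: dual_emb_def blinfun_inner_right.rep_eq)

lemma argmin_set_iff: "v \<in> argmin_set \<Phi> \<longleftrightarrow> (\<forall>w. \<Phi> v \<le> \<Phi> w)"
  by (simp add: argmin_set_def is_arg_min_linorder)

end

theory Submission
  imports Defs
begin

text \<open>
  Write \<open>q(t) = (1 + t)\<^sup>\<alpha>\<close>, let \<open>B = A + f\<close> be the gradient of \<open>\<Phi>\<close> and let \<open>z\<close> be the centre of a
  \<open>V\<close>-ball of radius \<open>r\<close> of minimizers. Multiplying the equation by \<open>q\<^sup>2 u'\<close> and by \<open>q (u - z)\<close> and
  combining the two identities shows that \<open>q |u'|\<close> is bounded and that \<open>q |u'|\<^sup>2\<close> and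
  \<open>q \<langle>B(u), u - z\<rangle>\<close> are integrable. Since \<open>\<langle>B(u), u - z - y\<rangle> \<ge> 0\<close> for \<open>\<parallel>y\<parallel> \<le> r\<close>, the last function
  dominates \<open>r q \<parallel>B(u)\<parallel>\<close> in \<open>V'\<close>, so the equation read as a first order equation for \<open>u'\<close> in \<open>V'\<close>
  shows that \<open>\<parallel>u'\<parallel>\<close> is integrable in \<open>V'\<close>: the trajectory is Cauchy in \<open>V'\<close>. The energy tends to its
  minimum, so the parallelogram identity for \<open>a\<close> and the convexity of \<open>F\<close> give
  \<open>a(u(t) - u(s), u(t) - u(s)) \<rightarrow> 0\<close>, and with \<open>|x|\<^sup>2 \<le> \<parallel>x\<parallel>\<^bsub>V'\<^esub> \<parallel>x\<parallel>\<^bsub>V\<^esub>\<close> coercivity makes the trajectory Cauchy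
  in \<open>V\<close>.
\<close>

subsection \<open>Increments of real functions\<close>

lemma abs_integrable_imp_integrable:
  fixes f :: "real \<Rightarrow> real"
  shows "f absolutely_integrable_on S \<Longrightarrow> f integrable_on S"
  by (rule set_lebesgue_integral_eq_integral(1))

text \<open>The interval is cut into \<open>n\<close> equal pieces of length
  \<open>h < \<delta>\<close>, and the local inequality is chained along the division
  points.\<close>

lemma locally_nonincreasing_imp_le:
  fixes H :: "real \<Rightarrow> real"
  assumes "a \<le> b" "0 < \<delta>"
    and step: "\<And>s t. \<lbrakk>a \<le> s; s \<le> t; t \<le> b; t - s < \<delta>\<rbrakk> \<Longrightarrow> H t \<le> H s"
  shows "H b \<le> H a"
proof -
  obtain n :: nat where n: "(b - a) / \<delta> < real n"
    using reals_Archimedean2 by blast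
  have n0: "0 < n"
    using n assms(1,2) by (metis divide_nonneg_pos diff_ge_0_iff_ge gr0I leD of_nat_0)
  define h where "h = (b - a) / n"
  have h: "0 \<le> h" "h < \<delta>" "n * h = b - a"
    using n n0 assms(1,2) by (auto simp: h_def field_simps)
  have "k \<le> n \<Longrightarrow> H (a + k * h) \<le> H a" for k
  proof (induction k)
    case (Suc k)
    have "real (Suc k) * h \<le> n * h"
      using Suc.prems h(1) by (intro mult_right_mono) auto
    then have "a + real (Suc k) * h \<le> b"
      using h(3) by linarith
    then have "H (a + real (Suc k) * h) \<le> H (a + real k * h)"
      using h by (intro step) (auto simp: algebra_simps)
    with Suc show ?case by simp
  qed simp
  from this[of n] h(3) show ?thesis by simp
qed

text \<open>
  Stands in for the almost everywhere differentiation of absolutely continuous functions, which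
  the library does not offer for values in a nonseparable space: an estimate of increments that
  is exact up to \<open>\<epsilon> \<cdot> \<integral>\<psi>\<close> on short intervals can be summed over a fine partition.
\<close>

lemma local_increment_bound:
  fixes G \<phi> \<psi> :: "real \<Rightarrow> real"
  assumes ab: "a \<le> b" and \<phi>: "\<phi> integrable_on {a..b}" and \<psi>: "\<psi> integrable_on {a..b}"
    and local: "\<And>\<epsilon>. 0 < \<epsilon> \<Longrightarrow> \<forall>\<^sub>F \<delta> in at_right 0. \<forall>s t. a \<le> s \<longrightarrow> s \<le> t \<longrightarrow> t \<le> b \<longrightarrow> t - s < \<delta> \<longrightarrow>
                  G t - G s \<le> integral {s..t} \<phi> + \<epsilon> * integral {s..t} \<psi>"
  shows "G b - G a \<le> integral {a..b} \<phi>"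
proof (rule field_le_epsilon)
  fix e :: real assume e: "0 < e"
  \<comment> \<open>Chosen so that \<open>\<epsilon> * integral {a..b} \<psi>\<close> is at most
    \<open>e\<close>; the added 1 keeps the denominator positive when the integral vanishes.\<close>
  define \<epsilon> where "\<epsilon> = e / (\<bar>integral {a..b} \<psi>\<bar> + 1)"
  have \<epsilon>: "0 < \<epsilon>"
    using e by (simp add: \<epsilon>_def add_nonneg_pos)
  have "\<epsilon> * integral {a..b} \<psi> \<le> \<epsilon> * (\<bar>integral {a..b} \<psi>\<bar> + 1)"
    using \<epsilon> by (intro mult_left_mono) auto
  also have "\<dots> = e"
    by (simp add: \<epsilon>_def add_nonneg_pos)
  finally have \<epsilon>_le: "\<epsilon> * integral {a..b} \<psi> \<le> e" .
  \<comment> \<open>Subtracting both integrals turns the local estimate into local monotonicity of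
    \<open>H\<close>.\<close>
  define H where "H t = G t - integral {a..t} \<phi> - \<epsilon> * integral {a..t} \<psi>" for t
  obtain \<delta> where \<delta>: "0 < \<delta>" "\<And>s t. \<lbrakk>a \<le> s; s \<le> t; t \<le> b; t - s < \<delta>\<rbrakk> \<Longrightarrow>
      G t - G s \<le> integral {s..t} \<phi> + \<epsilon> * integral {s..t} \<psi>"
    using eventually_happens[OF eventually_conj[OF local[OF \<epsilon>] eventually_at_right_less]]
    by auto
  have "H b \<le> H a"
  proof (rule locally_nonincreasing_imp_le[OF ab \<delta>(1)])
    fix s t assume st: "a \<le> s" "s \<le> t" "t \<le> b" "t - s < \<delta>"
    have "integral {a..s} \<phi> + integral {s..t} \<phi> = integral {a..t} \<phi>"
      "integral {a..s} \<psi> + integral {s..t} \<psi> = integral {a..t} \<psi>"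
      using st by (auto intro!: Henstock_Kurzweil_Integration.integral_combine integrable_subinterval_real[OF \<phi>]
          integrable_subinterval_real[OF \<psi>])
    then show "H t \<le> H s"
      using \<delta>(2)[OF st] unfolding H_def by (simp add: algebra_simps flip: \<open>_ = integral {a..t} \<phi>\<close> \<open>_ = integral {a..t} \<psi>\<close>)
  qed
  then show "G b - G a \<le> integral {a..b} \<phi> + e"
    using \<epsilon>_le by (simp add: H_def)
qed

text \<open>Heine-Cantor, phrased as a property of all small \<open>\<delta>\<close> so that the
  moduli of several functions can be combined by \<open>eventually_elim\<close>.\<close>

lemma uniform_modulus:
  fixes f :: "real \<Rightarrow> 'a::real_normed_vector"
  assumes f: "continuous_on {a..b} f" and "0 < \<epsilon>"
  shows "\<forall>\<^sub>F \<delta> in at_right 0. \<forall>s\<in>{a..b}. \<forall>t\<in>{a..b}. \<bar>t - s\<bar> < \<delta> \<longrightarrow> norm (f t - f s) \<le> \<epsilon>"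
proof -
  have "uniformly_continuous_on {a..b} f"
    using f by (intro compact_uniformly_continuous) auto
  then obtain d where d: "0 < d" "\<And>s t. \<lbrakk>s \<in> {a..b}; t \<in> {a..b}; \<bar>t - s\<bar> < d\<rbrakk> \<Longrightarrow> norm (f t - f s) < \<epsilon>"
    using \<open>0 < \<epsilon>\<close> unfolding uniformly_continuous_on_def dist_norm real_norm_def by metis
  show ?thesis
    unfolding eventually_at_right_field
    by (intro exI[of _ d] conjI allI impI ballI less_imp_le d) auto
qed

lemma absolutely_integrable_continuous_mult:
  fixes c \<phi> :: "real \<Rightarrow> real"
  assumes "continuous_on {a..b} c" "\<phi> absolutely_integrable_on {a..b}"
  shows "(\<lambda>t. c t * \<phi> t) absolutely_integrable_on {a..b}"
  using assms
  by (intro absolutely_integrable_bounded_measurable_product_real)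
     (auto intro: compact_imp_bounded compact_continuous_image
        continuous_imp_measurable_on_sets_lebesgue)

text \<open>Giving \<open>f\<close> the values of \<open>g\<close> on \<open>N\<close> leaves its
  integral unchanged and makes the comparison hold on all of \<open>S\<close>.\<close>

lemma integral_le_off_negligible:
  fixes f g :: "real \<Rightarrow> real"
  assumes f: "f integrable_on S" and g: "g integrable_on S" and N: "negligible N"
    and le: "\<And>x. x \<in> S - N \<Longrightarrow> f x \<le> g x"
  shows "integral S f \<le> integral S g"
proof -
  define f' where "f' x = (if x \<in> N then g x else f x)" for x
  have "f' integrable_on S"
    by (rule integrable_spike[OF f N]) (auto simp: f'_def)
  then have "integral S f' \<le> integral S g"
    by (rule integral_le[OF _ g]) (use le in \<open>auto simp: f'_def\<close>)
  moreover have "integral S f = integral S f'"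
    by (rule integral_spike[OF N]) (auto simp: f'_def)
  ultimately show ?thesis by simp
qed

text \<open>
  The hypothesis on \<open>c\<close> is a product because it has two uses: a \<open>C\<^sup>1\<close> weight with \<open>G\<close> of any
  sign, and a weight that is only bounded from above in its increments, with \<open>G \<ge> 0\<close>.
\<close>

lemma weighted_increment_bound:
  fixes G c \<phi> \<kappa> :: "real \<Rightarrow> real"
  assumes ab: "a \<le> b" and c: "continuous_on {a..b} c" "\<And>t. t \<in> {a..b} \<Longrightarrow> 0 \<le> c t"
    and G: "continuous_on {a..b} G"
    and \<phi>: "\<phi> absolutely_integrable_on {a..b}" and \<kappa>: "\<kappa> absolutely_integrable_on {a..b}"
    and G_inc: "\<And>s t. \<lbrakk>a \<le> s; s \<le> t; t \<le> b\<rbrakk> \<Longrightarrow> G t - G s \<le> integral {s..t} \<phi>"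
    and c_inc: "\<And>s t. \<lbrakk>a \<le> s; s \<le> t; t \<le> b\<rbrakk> \<Longrightarrow> (c t - c s) * G s \<le> integral {s..t} \<kappa> * G s"
  shows "c b * G b - c a * G a \<le> integral {a..b} (\<lambda>t. G t * \<kappa> t + c t * \<phi> t)"
proof (rule local_increment_bound[OF ab, where \<psi> = "\<lambda>t. \<bar>\<phi> t\<bar> + \<bar>\<kappa> t\<bar>"])
  note [intro!] = absolutely_integrable_continuous_mult
  have i1: "(\<lambda>t. G t * \<kappa> t + c t * \<phi> t) absolutely_integrable_on {a..b}"
    using G c(1) \<phi> \<kappa> by (intro set_integral_add) auto
  have i2: "(\<lambda>t. \<bar>\<phi> t\<bar> + \<bar>\<kappa> t\<bar>) absolutely_integrable_on {a..b}"
    using \<phi> \<kappa> by (intro set_integral_add set_integrable_abs) auto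
  show "(\<lambda>t. G t * \<kappa> t + c t * \<phi> t) integrable_on {a..b}" "(\<lambda>t. \<bar>\<phi> t\<bar> + \<bar>\<kappa> t\<bar>) integrable_on {a..b}"
    using i1 i2 set_lebesgue_integral_eq_integral(1) by blast+
  fix \<epsilon> :: real assume "0 < \<epsilon>"
  show "\<forall>\<^sub>F \<delta> in at_right 0. \<forall>s t. a \<le> s \<longrightarrow> s \<le> t \<longrightarrow> t \<le> b \<longrightarrow> t - s < \<delta> \<longrightarrow>
          c t * G t - c s * G s \<le> integral {s..t} (\<lambda>t. G t * \<kappa> t + c t * \<phi> t)
             + \<epsilon> * integral {s..t} (\<lambda>t. \<bar>\<phi> t\<bar> + \<bar>\<kappa> t\<bar>)"
    using uniform_modulus[OF c(1) \<open>0 < \<epsilon>\<close>] uniform_modulus[OF G \<open>0 < \<epsilon>\<close>]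
  proof eventually_elim
    case (elim \<delta>)
    show ?case
    proof (intro allI impI)
      fix s t assume st: "a \<le> s" "s \<le> t" "t \<le> b" "t - s < \<delta>"
      have sub: "{s..t} \<subseteq> {a..b}" using st by auto
      have I: "\<phi> integrable_on {s..t}" "\<kappa> integrable_on {s..t}"
        "(\<lambda>t. G t * \<kappa> t + c t * \<phi> t) integrable_on {s..t}" "(\<lambda>t. \<bar>\<phi> t\<bar> + \<bar>\<kappa> t\<bar>) integrable_on {s..t}"
        using \<phi> \<kappa> i1 i2 absolutely_integrable_on_subinterval[OF _ sub]
          set_lebesgue_integral_eq_integral(1) by blast+
      \<comment> \<open>Discrete product rule: \<open>c\<close> is taken at the right endpoint and
        \<open>G\<close> at the left one, the form in which \<open>c_inc\<close> supplies its
        bound.\<close>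
      have "c t * G t - c s * G s = c t * (G t - G s) + (c t - c s) * G s"
        by (simp add: algebra_simps)
      also have "\<dots> \<le> c t * integral {s..t} \<phi> + integral {s..t} \<kappa> * G s"
        using st G_inc c_inc c(2) by (intro add_mono mult_left_mono) auto
      also have "\<dots> = integral {s..t} (\<lambda>\<tau>. c t * \<phi> \<tau> + G s * \<kappa> \<tau>)"
        using I by (simp add: integral_add integrable_on_mult_right)
      also have "\<dots> \<le> integral {s..t} (\<lambda>t. (G t * \<kappa> t + c t * \<phi> t) + \<epsilon> * (\<bar>\<phi> t\<bar> + \<bar>\<kappa> t\<bar>))"
      proof (rule integral_le)
        fix \<tau> assume \<tau>: "\<tau> \<in> {s..t}"
        have "\<bar>c t - c \<tau>\<bar> \<le> \<epsilon>" "\<bar>G s - G \<tau>\<bar> \<le> \<epsilon>"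
          using elim st \<tau> by (auto simp: abs_minus_commute)
        then have "\<bar>c t - c \<tau>\<bar> * \<bar>\<phi> \<tau>\<bar> \<le> \<epsilon> * \<bar>\<phi> \<tau>\<bar>" "\<bar>G s - G \<tau>\<bar> * \<bar>\<kappa> \<tau>\<bar> \<le> \<epsilon> * \<bar>\<kappa> \<tau>\<bar>"
          by (auto intro: mult_right_mono)
        then have "(c t - c \<tau>) * \<phi> \<tau> \<le> \<epsilon> * \<bar>\<phi> \<tau>\<bar>" "(G s - G \<tau>) * \<kappa> \<tau> \<le> \<epsilon> * \<bar>\<kappa> \<tau>\<bar>"
          by (metis abs_ge_self abs_mult order_trans)+
        then show "c t * \<phi> \<tau> + G s * \<kappa> \<tau> \<le> (G \<tau> * \<kappa> \<tau> + c \<tau> * \<phi> \<tau>) + \<epsilon> * (\<bar>\<phi> \<tau>\<bar> + \<bar>\<kappa> \<tau>\<bar>)"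
          by (simp add: algebra_simps)
      qed (use I in \<open>auto intro!: integrable_add integrable_on_mult_right\<close>)
      also have "\<dots> = integral {s..t} (\<lambda>t. G t * \<kappa> t + c t * \<phi> t)
             + \<epsilon> * integral {s..t} (\<lambda>t. \<bar>\<phi> t\<bar> + \<bar>\<kappa> t\<bar>)"
        using I(3,4) by (simp add: integral_add integrable_on_mult_right del: distrib_left_numeral)
      finally show "c t * G t - c s * G s \<le> \<dots>" .
    qed
  qed
qed

lemma bound_on_interval:
  fixes c :: "real \<Rightarrow> 'a::real_normed_vector"
  assumes "continuous_on {a..b} c"
  obtains M where "0 \<le> M" "\<And>t. t \<in> {a..b} \<Longrightarrow> norm (c t) \<le> M"
proof -
  have "bounded (c ` {a..b})"
    using assms by (intro compact_imp_bounded compact_continuous_image) auto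
  then obtain M where "0 < M" "\<forall>x\<in>c ` {a..b}. norm x \<le> M"
    unfolding bounded_pos by auto
  then show ?thesis by (intro that[of M]) auto
qed

lemma has_integral_real_derivative:
  fixes c :: "real \<Rightarrow> real"
  assumes "s \<le> t" "0 \<le> s" "\<And>t. 0 \<le> t \<Longrightarrow> (c has_real_derivative c' t) (at t)"
  shows "(c' has_integral (c t - c s)) {s..t}"
proof (rule fundamental_theorem_of_calculus[OF assms(1)])
  fix x assume "x \<in> {s..t}"
  then have "(c has_real_derivative c' x) (at x within {s..t})"
    using assms(2) by (intro has_field_derivative_at_within[OF assms(3)]) auto
  then show "(c has_vector_derivative c' x) (at x within {s..t})"
    by (simp add: has_real_derivative_iff_has_vector_derivative)
qed

text \<open>The integrals over \<open>{T..b}\<close> grow with \<open>b\<close> and stay below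
  \<open>C\<close>. Once they are within \<open>\<epsilon>\<close> of their supremum, only
  \<open>\<epsilon>\<close> is left for any later piece.\<close>

lemma bounded_integrals_imp_small_tails:
  fixes h :: "real \<Rightarrow> real"
  assumes int: "\<And>b. h integrable_on {T..b}" and nonneg: "\<And>t. T \<le> t \<Longrightarrow> 0 \<le> h t"
    and bdd: "\<And>b. T \<le> b \<Longrightarrow> integral {T..b} h \<le> C" and "0 < \<epsilon>"
  obtains S where "T \<le> S" "\<And>s t. \<lbrakk>S \<le> s; s \<le> t\<rbrakk> \<Longrightarrow> integral {s..t} h \<le> \<epsilon>"
proof -
  define X where "X = (\<lambda>b. integral {T..b} h) ` {T..}"
  have X: "X \<noteq> {}" "bdd_above X"
    using bdd by (auto simp: X_def bdd_above_def)
  then have "\<exists>x\<in>X. Sup X - \<epsilon> < x"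
    using less_cSup_iff[OF X, of "Sup X - \<epsilon>"] \<open>0 < \<epsilon>\<close> by simp
  then obtain S where S: "T \<le> S" "Sup X - \<epsilon> < integral {T..S} h"
    by (auto simp: X_def)
  show ?thesis
  proof (rule that[OF S(1)])
    fix s t assume st: "S \<le> s" "s \<le> t"
    have "integral {T..S} h \<le> integral {T..s} h"
      using st S nonneg int by (intro integral_subset_le) auto
    moreover have "integral {T..s} h + integral {s..t} h = integral {T..t} h"
      by (rule Henstock_Kurzweil_Integration.integral_combine) (use st S int in auto)
    moreover have "integral {T..t} h \<le> Sup X"
      using st S by (intro cSup_upper X) (auto simp: X_def)
    ultimately show "integral {s..t} h \<le> \<epsilon>" using S by linarith
  qed
qed

subsection \<open>Sobolev functions on the half-line and the dual embedding\<close>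

lemma L1_on_norm_integrable:
  assumes "L1_on S f" "S \<in> sets lebesgue"
  shows "(\<lambda>t. norm (f t)) absolutely_integrable_on S"
  using assms integrable_on_lebesgue_on[of S "\<lambda>t. norm (f t)"]
  by (intro nonnegative_absolutely_integrable_1) (auto simp: L1_on_def)

lemma L1_loc_norm_integrable:
  assumes "L1_loc f" "0 \<le> a"
  shows "(\<lambda>t. norm (f t)) absolutely_integrable_on {a..b}"
proof (cases "0 \<le> b")
  case True
  then have "(\<lambda>t. norm (f t)) absolutely_integrable_on {0..b}"
    using assms by (intro L1_on_norm_integrable) (auto simp: L1_loc_def)
  then show ?thesis
    by (rule absolutely_integrable_on_subinterval) (use assms in auto)
next
  case False
  with assms have "{a..b} = {}" by auto
  then show ?thesis by (simp add: set_integrable_def)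
qed

text \<open>Additivity moves the base point from 0 to any \<open>s\<close>; the short-interval
  estimates below start from this form.\<close>

lemma W11_loc_deriv_has_integral:
  fixes u :: "real \<Rightarrow> 'a::banach"
  assumes u: "W11_loc_deriv u u'" and "0 \<le> s" "s \<le> t"
  shows "(u' has_integral (u t - u s)) {s..t}"
proof -
  have *: "(u' has_integral (u r - u 0)) {0..r}" if "0 \<le> r" for r
    using u that by (auto simp: W11_loc_deriv_def)
  have i: "u' integrable_on {0..t}" "0 \<le> t"
    using *[of t] assms by auto
  have "u' integrable_on {s..t}"
    using integrable_subinterval_real[OF i(1)] assms by auto
  moreover have "integral {0..s} u' + integral {s..t} u' = integral {0..t} u'"
    by (rule Henstock_Kurzweil_Integration.integral_combine) (use assms i in auto)
  ultimately show ?thesis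
    using *[of s] *[of t] assms i(2)
    by (metis (no_types, lifting) add_diff_cancel_left' diff_add_cancel diff_diff_eq2 has_integral_integral integral_unique add_diff_eq)
qed

lemma W11_loc_deriv_continuous:
  fixes u :: "real \<Rightarrow> 'a::banach"
  assumes u: "W11_loc_deriv u u'" and "0 \<le> a"
  shows "continuous_on {a..b} u"
proof (cases "a \<le> b")
  case True
  have h: "(u' has_integral (u t - u a)) {a..t}" if "a \<le> t" for t
    using W11_loc_deriv_has_integral[OF u \<open>0 \<le> a\<close> that] .
  have "continuous_on {a..b} (\<lambda>x. integral {a..x} u' + u a)"
    using h[OF True] by (intro continuous_on_add indefinite_integral_continuous_1) auto
  moreover have "integral {a..x} u' + u a = u x" if "x \<in> {a..b}" for x
    using integral_unique[OF h, of x] that by simp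
  ultimately show ?thesis
    by (subst continuous_on_cong[OF refl, of _ _ "\<lambda>x. integral {a..x} u' + u a"]) auto
qed simp

lemma W11_loc_deriv_norm_le:
  fixes u :: "real \<Rightarrow> 'a::banach"
  assumes u: "W11_loc_deriv u u'" and st: "0 \<le> s" "s \<le> t"
  shows "norm (u t - u s) \<le> integral {s..t} (\<lambda>t. norm (u' t))"
proof -
  note h = W11_loc_deriv_has_integral[OF u st]
  have "norm (integral {s..t} u') \<le> integral {s..t} (\<lambda>t. norm (u' t))"
    using h L1_loc_norm_integrable[of u' s t] u st(1)
    by (intro integral_norm_bound_integral)
       (auto simp: W11_loc_deriv_def intro: set_lebesgue_integral_eq_integral(1))
  then show ?thesis using h by (simp add: integral_unique)
qed

lemma AE_lebesgue_on_imp_negligible: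
  assumes "AE t in lebesgue_on S. P t" "S \<in> sets lebesgue"
  obtains N where "negligible N" "\<And>t. t \<in> S - N \<Longrightarrow> P t"
proof -
  have "AE t in lebesgue. t \<in> S \<longrightarrow> P t"
    using assms by (simp add: AE_restrict_space_iff)
  then have "{t. \<not> (t \<in> S \<longrightarrow> P t)} \<in> null_sets lebesgue"
    by (simp add: completion.AE_iff_null_sets)
  then show ?thesis
    by (intro that[of "{t. \<not> (t \<in> S \<longrightarrow> P t)}"]) (auto simp: negligible_iff_null_sets)
qed

text \<open>If the bound failed at \<open>t\<close>, continuity would make it fail on a whole
  interval to the right of \<open>t\<close>, which is not negligible.\<close>

lemma AE_bounded_continuous_imp_bounded:
  fixes c :: "real \<Rightarrow> 'a::real_normed_vector"
  assumes c: "\<And>a b. 0 \<le> a \<Longrightarrow> continuous_on {a..b} c"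
    and AE: "AE t in lebesgue_on {0..}. norm (c t) \<le> C" and t: "0 \<le> t"
  shows "norm (c t) \<le> C"
proof (rule ccontr)
  assume "\<not> ?thesis"
  then have gap: "0 < (norm (c t) - C) / 2" by simp
  obtain N where N: "negligible N" "\<And>t. t \<in> {0..} - N \<Longrightarrow> norm (c t) \<le> C"
    using AE_lebesgue_on_imp_negligible[OF AE] by auto
  obtain \<delta> where \<delta>: "0 < \<delta>" "\<And>s. \<lbrakk>s \<in> {t..t+1}; \<bar>s - t\<bar> < \<delta>\<rbrakk> \<Longrightarrow> norm (c s - c t) \<le> (norm (c t) - C) / 2"
    using eventually_happens[OF eventually_conj[OF uniform_modulus[OF c[OF t, of "t + 1"] gap] eventually_at_right_less]]
    by fastforce
  \<comment> \<open>The 1 keeps points inside \<open>{t..t+1}\<close>, where the modulus applies;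
    the half makes \<open>\<eta>\<close> strictly smaller than \<open>\<delta>\<close>.\<close>
  define \<eta> where "\<eta> = min 1 (\<delta> / 2)"
  have \<eta>: "0 < \<eta>" "\<eta> \<le> 1" "\<eta> < \<delta>" using \<delta>(1) by (auto simp: \<eta>_def)
  have "{t..t + \<eta>} \<subseteq> N"
  proof
    fix s assume s: "s \<in> {t..t + \<eta>}"
    then have "norm (c t) - norm (c s) \<le> (norm (c t) - C) / 2"
      using \<delta>(2)[of s] \<eta> norm_triangle_ineq3[of "c s" "c t"] by auto
    then have "\<not> norm (c s) \<le> C" using gap by auto
    then show "s \<in> N" using N(2)[of s] s t by auto
  qed
  then have "negligible (cbox t (t + \<eta>))"
    using N(1) negligible_subset by auto
  then show False
    using \<eta>(1) unfolding negligible_interval by auto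
qed

lemma bounded_linear_dual_emb: "bounded_linear (dual_emb \<iota>)"
  unfolding dual_emb_def
  by (intro bounded_linear_compose[OF bounded_bilinear.bounded_linear_left[OF bounded_bilinear_blinfun_compose]]
      bounded_linear_blinfun_inner_right)

lemma dual_emb_diff: "dual_emb \<iota> (x - y) = dual_emb \<iota> x - dual_emb \<iota> y"
  by (rule blinfun_eqI) (simp add: dual_emb_apply blinfun.diff_left inner_diff_left)

lemma norm_dual_emb_le: "norm (dual_emb \<iota> x) \<le> norm \<iota> * norm x"
proof (rule norm_blinfun_bound)
  fix v
  have "norm (dual_emb \<iota> x v) \<le> norm x * norm (\<iota> v)"
    by (simp add: dual_emb_apply Cauchy_Schwarz_ineq2)
  also have "\<dots> \<le> norm x * (norm \<iota> * norm v)"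
    by (intro mult_left_mono norm_blinfun) auto
  finally show "norm (dual_emb \<iota> x v) \<le> norm \<iota> * norm x * norm v" by (simp add: ac_simps)
qed simp

subsection \<open>Convexity and limits\<close>

text \<open>Along the line through \<open>v\<close> and \<open>y\<close>, \<open>F\<close> becomes a
  convex function \<open>h\<close> of one real variable with derivative \<open>D (y - v)\<close> at
  0; its value at 1 is compared with the tangent at 0.\<close>

lemma convex_on_has_derivative_above_tangent:
  assumes F: "convex_on UNIV F" and D: "(F has_derivative D) (at v)"
  shows "F v + D (y - v) \<le> F y"
proof -
  interpret D: bounded_linear D using D by (rule has_derivative_bounded_linear)
  define h where "h s = F (v + s *\<^sub>R (y - v))" for s :: real
  have "convex_on UNIV h"
  proof (rule convex_onI)
    fix t s s' :: real assume "0 < t" "t < 1"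
    then have "F ((1 - t) *\<^sub>R (v + s *\<^sub>R (y - v)) + t *\<^sub>R (v + s' *\<^sub>R (y - v))) \<le> (1 - t) * h s + t * h s'"
      unfolding h_def by (intro convex_onD[OF F]) auto
    moreover have "(1 - t) *\<^sub>R (v + s *\<^sub>R (y - v)) + t *\<^sub>R (v + s' *\<^sub>R (y - v))
        = v + ((1 - t) *\<^sub>R s + t *\<^sub>R s') *\<^sub>R (y - v)"
      by (simp add: algebra_simps)
    ultimately show "h ((1 - t) *\<^sub>R s + t *\<^sub>R s') \<le> (1 - t) * h s + t * h s'"
      by (simp add: h_def)
  qed auto
  moreover have "(h has_real_derivative D (y - v)) (at 0 within UNIV)"
  proof -
    have "((\<lambda>s. v + s *\<^sub>R (y - v)) has_derivative (\<lambda>s. s *\<^sub>R (y - v))) (at 0)"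
      by (auto intro!: derivative_eq_intros)
    then have "(h has_derivative (\<lambda>s. D (s *\<^sub>R (y - v)))) (at 0)"
      unfolding h_def by (rule has_derivative_compose) (use D in simp)
    then show ?thesis
      by (simp add: has_field_derivative_def D.scaleR mult_commute_abs)
  qed
  ultimately have "D (y - v) * (1 - 0) \<le> h 1 - h 0"
    by (intro convex_on_imp_above_tangent[of UNIV]) auto
  then show ?thesis by (simp add: h_def)
qed

text \<open>The limit is found along the integers and then carried to all real times by the Cauchy
  bound.\<close>

lemma convergent_at_top_if_Cauchy:
  fixes u :: "real \<Rightarrow> 'a::banach"
  assumes Cauchy: "\<And>e. 0 < e \<Longrightarrow> \<exists>S. \<forall>s t. S \<le> s \<longrightarrow> s \<le> t \<longrightarrow> norm (u t - u s) \<le> e"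
  shows "\<exists>v. (u \<longlongrightarrow> v) at_top"
proof -
  have "Cauchy (\<lambda>n. u (real n))"
  proof (rule CauchyI')
    fix e :: real assume "0 < e"
    then obtain S where S: "\<And>s t. S \<le> s \<Longrightarrow> s \<le> t \<Longrightarrow> norm (u t - u s) \<le> e / 2"
      using Cauchy[of "e / 2"] by auto
    obtain M :: nat where "S \<le> real M"
      using real_arch_simple by blast
    have "dist (u (real m)) (u (real n)) < e" if "M \<le> m" "m < n" for m n
    proof -
      have "norm (u (real n) - u (real m)) \<le> e / 2"
        using \<open>S \<le> real M\<close> that by (intro S) auto
      then show ?thesis
        using \<open>0 < e\<close> by (simp add: dist_norm norm_minus_commute)
    qed
    then have "\<forall>m\<ge>M. \<forall>n>m. dist (u (real m)) (u (real n)) < e" by blast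
    then show "\<exists>M. \<forall>m\<ge>M. \<forall>n>m. dist (u (real m)) (u (real n)) < e" ..
  qed
  then obtain v where v: "(\<lambda>n. u (real n)) \<longlonglongrightarrow> v"
    using Cauchy_convergent convergent_def by blast
  have "(u \<longlongrightarrow> v) at_top"
  proof (rule tendstoI)
    fix e :: real assume e: "0 < e"
    then obtain S where S: "\<And>s t. S \<le> s \<Longrightarrow> s \<le> t \<Longrightarrow> norm (u t - u s) \<le> e / 2"
      using Cauchy[of "e / 2"] by auto
    have "dist (u t) v \<le> e / 2" if t: "S \<le> t" for t
    proof (rule Lim_dist_ubound[OF sequentially_bot v])
      obtain N :: nat where "t \<le> real N" using real_arch_simple by blast
      then have "dist (u t) (u (real n)) \<le> e / 2" if "N \<le> n" for n
        using S[OF t, of "real n"] that by (simp add: dist_norm norm_minus_commute)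
      then show "\<forall>\<^sub>F n in sequentially. dist (u t) (u (real n)) \<le> e / 2"
        by (auto simp: eventually_sequentially)
    qed
    then show "\<forall>\<^sub>F t in at_top. dist (u t) v < e"
      using e by (intro eventually_at_top_linorderI[of S]) fastforce
  qed
  then show ?thesis ..
qed

subsection \<open>Increments along a damped gradient flow\<close>

text \<open>Convexity is encoded by the tangent inequality \<open>grad_ineq\<close>, with
  \<open>B\<close> in the role of the gradient. \<open>w\<close> is the derivative of
  \<open>u\<close> in \<open>V\<close>, while \<open>u'\<close> is the derivative of its image in
  \<open>H\<close>.\<close>

locale damped_gradient_flow =
  fixes \<iota> :: "'v::{real_inner,banach} \<Rightarrow>\<^sub>L 'h::{real_inner,banach}"
    and B :: "'v \<Rightarrow> ('v \<Rightarrow>\<^sub>L real)"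
    and \<Phi> :: "'v \<Rightarrow> real"
    and \<gamma> :: "real \<Rightarrow> real"
    and g :: "real \<Rightarrow> 'h"
    and u w :: "real \<Rightarrow> 'v"
    and u' u'' :: "real \<Rightarrow> 'h"
  assumes gamma_cont: "\<And>a b. 0 \<le> a \<Longrightarrow> continuous_on {a..b} \<gamma>"
    and gamma_nonneg: "\<And>t. 0 \<le> t \<Longrightarrow> 0 \<le> \<gamma> t"
    and grad_cont: "continuous_on UNIV B"
    and grad_ineq: "\<And>v y. \<Phi> v + B v (y - v) \<le> \<Phi> y"
    and g_int: "(\<lambda>t. norm (g t)) absolutely_integrable_on {0..}"
    and u_V: "W11_loc_deriv u w"
    and u_H: "W11_loc_deriv (\<lambda>t. \<iota> (u t)) u'"
    and u'_H: "W11_loc_deriv u' u''"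
    and equation: "AE t in lebesgue_on {0..}.
           dual_emb \<iota> (u'' t) + \<gamma> t *\<^sub>R dual_emb \<iota> (u' t) + B (u t) = dual_emb \<iota> (g t)"
begin

section \<open>Regularity of the data along the trajectory\<close>

lemma g_int_on: "0 \<le> a \<Longrightarrow> (\<lambda>t. norm (g t)) absolutely_integrable_on {a..b}"
  by (rule absolutely_integrable_on_subinterval[OF g_int]) auto

lemmas w_int_on = L1_loc_norm_integrable[OF conjunct1[OF u_V[unfolded W11_loc_deriv_def]]]
lemmas u''_int_on = L1_loc_norm_integrable[OF conjunct1[OF u'_H[unfolded W11_loc_deriv_def]]]
lemmas u_cont = W11_loc_deriv_continuous[OF u_V]
lemmas u'_cont = W11_loc_deriv_continuous[OF u'_H]

lemma Bu_cont: "0 \<le> a \<Longrightarrow> continuous_on {a..b} (\<lambda>t. B (u t))"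
  by (rule continuous_on_compose2[OF grad_cont u_cont]) auto

text \<open>The equation is paired with one fixed \<open>v\<close> and integrated in time.
  Cauchy-Schwarz for the source leaves an inequality, and the majorant \<open>\<theta>\<close> lets
  each application freeze the terms it chooses.\<close>

lemma weak_increment:
  assumes st: "0 \<le> s" "s \<le> t" and \<theta>: "\<theta> integrable_on {s..t}"
    and le: "\<And>\<tau>. \<tau> \<in> {s..t} \<Longrightarrow>
      norm (g \<tau>) * norm (\<iota> v) - \<gamma> \<tau> * (u' \<tau> \<bullet> \<iota> v) - B (u \<tau>) v \<le> \<theta> \<tau>"
  shows "(u' t - u' s) \<bullet> \<iota> v \<le> integral {s..t} \<theta>"
proof -
  obtain N where N: "negligible N" "\<And>t. t \<in> {0..} - N \<Longrightarrow>
      dual_emb \<iota> (u'' t) + \<gamma> t *\<^sub>R dual_emb \<iota> (u' t) + B (u t) = dual_emb \<iota> (g t)"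
    using AE_lebesgue_on_imp_negligible[OF equation] by auto
  have eq: "u'' \<tau> \<bullet> \<iota> v = g \<tau> \<bullet> \<iota> v - \<gamma> \<tau> * (u' \<tau> \<bullet> \<iota> v) - B (u \<tau>) v" if "\<tau> \<in> {0..} - N" for \<tau>
    using arg_cong[OF N(2)[OF that], of "\<lambda>x. blinfun_apply x v"]
    by (simp add: blinfun.add_left blinfun.scaleR_left dual_emb_apply)
  have hi: "((\<lambda>\<tau>. u'' \<tau> \<bullet> \<iota> v) has_integral (u' t - u' s) \<bullet> \<iota> v) {s..t}"
    using has_integral_linear[OF W11_loc_deriv_has_integral[OF u'_H st] bounded_linear_inner_left]
    by (simp add: o_def)
  have "integral {s..t} (\<lambda>\<tau>. u'' \<tau> \<bullet> \<iota> v) \<le> integral {s..t} \<theta>"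
  proof (rule integral_le_off_negligible[OF has_integral_integrable[OF hi] \<theta> N(1)])
    fix \<tau> assume \<tau>: "\<tau> \<in> {s..t} - N"
    have "g \<tau> \<bullet> \<iota> v \<le> norm (g \<tau>) * norm (\<iota> v)" by (rule norm_cauchy_schwarz)
    then show "u'' \<tau> \<bullet> \<iota> v \<le> \<theta> \<tau>"
      using le[of \<tau>] eq[of \<tau>] \<tau> st by auto
  qed
  then show ?thesis using hi by (simp add: integral_unique)
qed

text \<open>The difference quotient, mapped to \<open>H\<close>, is the mean of \<open>u'\<close>
  over \<open>{s..t}\<close>, hence as close to \<open>c\<close> as \<open>u'\<close>
  itself.\<close>

lemma mean_velocity:
  assumes st: "0 \<le> s" "s < t" and c: "\<And>\<tau>. \<tau> \<in> {s..t} \<Longrightarrow> norm (u' \<tau> - c) \<le> \<epsilon>"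
  shows "norm (\<iota> ((1 / (t - s)) *\<^sub>R (u t - u s)) - c) \<le> \<epsilon>"
proof -
  have "((\<lambda>\<tau>. u' \<tau> - c) has_integral (\<iota> (u t) - \<iota> (u s)) - (t - s) *\<^sub>R c) {s..t}"
    using W11_loc_deriv_has_integral[OF u_H, of s t] has_integral_const_real[of c s t] st
    by (intro has_integral_diff) auto
  note hi = this
  have "norm (integral {s..t} (\<lambda>\<tau>. u' \<tau> - c)) \<le> integral {s..t} (\<lambda>\<tau>. \<epsilon>)"
    by (intro integral_norm_bound_integral has_integral_integrable[OF hi] integrable_const_ivl c)
  then have *: "norm ((\<iota> (u t) - \<iota> (u s)) - (t - s) *\<^sub>R c) \<le> (t - s) * \<epsilon>"
    using st by (simp add: integral_unique[OF hi])
  have "\<iota> ((1 / (t - s)) *\<^sub>R (u t - u s)) - c = (1 / (t - s)) *\<^sub>R ((\<iota> (u t) - \<iota> (u s)) - (t - s) *\<^sub>R c)"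
    using st by (simp add: blinfun.scaleR_right blinfun.diff_right scaleR_diff_right)
  also have "norm \<dots> \<le> (1 / (t - s)) * ((t - s) * \<epsilon>)"
    unfolding norm_scaleR using * st by (intro mult_mono) auto
  also have "\<dots> = \<epsilon>" using st by simp
  finally show ?thesis .
qed

lemma energy_rate_integrable:
  "0 \<le> a \<Longrightarrow> (\<lambda>t. norm (u' t) * norm (g t) - \<gamma> t * (norm (u' t))\<^sup>2) absolutely_integrable_on {a..b}"
  by (intro set_integral_diff absolutely_integrable_continuous_mult absolutely_integrable_continuous_real
      g_int_on continuous_intros u'_cont gamma_cont)

text \<open>
  Testing the equation in \<open>V'\<close> with \<open>u'\<close> would need the almost everywhere \<open>V\<close>-valued derivative
  of \<open>u\<close>. On a short interval it is tested instead with the difference quotient of \<open>u\<close>, which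
  lies in \<open>V\<close> and is uniformly close to \<open>u'\<close> in \<open>H\<close>; convexity absorbs the increment of \<open>\<Phi>\<close>.
\<close>

lemma energy_increment:
  assumes ab: "0 \<le> a" "a \<le> b"
  shows "((norm (u' b))\<^sup>2 / 2 + \<Phi> (u b)) - ((norm (u' a))\<^sup>2 / 2 + \<Phi> (u a))
           \<le> integral {a..b} (\<lambda>t. norm (u' t) * norm (g t) - \<gamma> t * (norm (u' t))\<^sup>2)"
proof -
  obtain M where M: "0 \<le> M" "\<And>t. t \<in> {a..b} \<Longrightarrow> norm (u' t) \<le> M"
    using bound_on_interval[OF u'_cont[OF ab(1)]] by blast
  define \<phi> where "\<phi> t = norm (u' t) * norm (g t) - \<gamma> t * (norm (u' t))\<^sup>2" for t
  \<comment> \<open>\<open>\<psi>1\<close> carries the error of exchanging \<open>\<iota> v\<close>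
    and \<open>u' \<tau>\<close> in the source and damping terms; \<open>\<psi>\<close> adds the
    variation of \<open>u'\<close> in \<open>H\<close> and of \<open>u\<close> in
    \<open>V\<close>.\<close>
  define \<psi>1 where "\<psi>1 t = norm (g t) + M * \<gamma> t" for t
  define \<psi> where "\<psi> t = \<psi>1 t + norm (u'' t) + norm (w t)" for t
  have I: "\<phi> absolutely_integrable_on {s..t}" "\<psi>1 absolutely_integrable_on {s..t}"
    "\<psi> absolutely_integrable_on {s..t}" if "0 \<le> s" for s t
    unfolding \<phi>_def \<psi>_def \<psi>1_def using that
    by (intro energy_rate_integrable set_integral_add absolutely_integrable_continuous_mult
        absolutely_integrable_continuous_real g_int_on w_int_on u''_int_on continuous_intros
        gamma_cont; assumption)+
  note I' = I[THEN abs_integrable_imp_integrable]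
  have "((norm (u' b))\<^sup>2 / 2 + \<Phi> (u b)) - ((norm (u' a))\<^sup>2 / 2 + \<Phi> (u a)) \<le> integral {a..b} \<phi>"
  proof (rule local_increment_bound[OF ab(2) I'(1,3)])
    fix \<epsilon> :: real assume \<epsilon>: "0 < \<epsilon>"
    show "\<forall>\<^sub>F \<delta> in at_right 0. \<forall>s t. a \<le> s \<longrightarrow> s \<le> t \<longrightarrow> t \<le> b \<longrightarrow> t - s < \<delta> \<longrightarrow>
            ((norm (u' t))\<^sup>2 / 2 + \<Phi> (u t)) - ((norm (u' s))\<^sup>2 / 2 + \<Phi> (u s))
              \<le> integral {s..t} \<phi> + \<epsilon> * integral {s..t} \<psi>"
      using uniform_modulus[OF u'_cont[OF ab(1), of b] \<epsilon>] uniform_modulus[OF Bu_cont[OF ab(1), of b] \<epsilon>]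
    proof eventually_elim
      case (elim \<delta>)
      show ?case
      proof (intro allI impI)
        fix s t assume st: "a \<le> s" "s \<le> t" "t \<le> b" "t - s < \<delta>"
        show "((norm (u' t))\<^sup>2 / 2 + \<Phi> (u t)) - ((norm (u' s))\<^sup>2 / 2 + \<Phi> (u s))
              \<le> integral {s..t} \<phi> + \<epsilon> * integral {s..t} \<psi>"
        proof (cases "s = t")
          case False
          with st ab have lt: "s < t" and s0: "0 \<le> s" by auto
          have u'_near: "norm (u' r - u' \<tau>) \<le> \<epsilon>" if "r \<in> {s..t}" "\<tau> \<in> {s..t}" for r \<tau>
            using elim(1) that st by auto
          define d where "d = u t - u s"
          define v where "v = (1 / (t - s)) *\<^sub>R d"
          \<comment> \<open>The increment of half the squared speed is exactly
            \<open>(u' t - u' s) \<bullet> m\<close>, so only the distance from \<open>m\<close> to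
            \<open>\<iota> v\<close> has to be paid for.\<close>
          define m where "m = (1/2) *\<^sub>R (u' t + u' s)"
          have d_v: "d = (t - s) *\<^sub>R v" using lt by (simp add: v_def)
          have v_near: "norm (\<iota> v - u' \<tau>) \<le> \<epsilon>" if "\<tau> \<in> {s..t}" for \<tau>
            unfolding v_def d_def by (rule mean_velocity[OF s0 lt]) (use u'_near that in auto)
          have m_near: "norm (m - \<iota> v) \<le> \<epsilon>"
          proof -
            have "norm (u' t - \<iota> v) \<le> \<epsilon>" "norm (u' s - \<iota> v) \<le> \<epsilon>"
              using v_near[of t] v_near[of s] lt by (auto simp: norm_minus_commute)
            moreover have "m - \<iota> v = (1/2) *\<^sub>R ((u' t - \<iota> v) + (u' s - \<iota> v))"
              by (simp add: m_def algebra_simps flip: scaleR_add_left)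
            ultimately show ?thesis
              using norm_triangle_ineq[of "u' t - \<iota> v" "u' s - \<iota> v"] by simp
          qed
          \<comment> \<open>\<open>c\<close> freezes the gradient at the right endpoint; integrated,
            it becomes \<open>\<epsilon> * norm d - B (u t) d\<close>, whose last term offsets the
            increment of \<open>\<Phi>\<close> bounded by the tangent at \<open>u t\<close>.\<close>
          define c where "c = \<epsilon> * norm v - B (u t) v"
          have "(u' t - u' s) \<bullet> \<iota> v \<le> integral {s..t} (\<lambda>\<tau>. (\<phi> \<tau> + \<epsilon> * \<psi>1 \<tau>) + c)"
          proof (rule weak_increment)
            show "(\<lambda>\<tau>. (\<phi> \<tau> + \<epsilon> * \<psi>1 \<tau>) + c) integrable_on {s..t}"
              using I'[OF s0] by (intro integrable_add integrable_on_mult_right integrable_const_ivl)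
            fix \<tau> assume \<tau>: "\<tau> \<in> {s..t}"
            have "norm (\<iota> v) \<le> norm (u' \<tau>) + \<epsilon>"
              using v_near[OF \<tau>] norm_triangle_sub[of "\<iota> v" "u' \<tau>"] by linarith
            then have 1: "norm (g \<tau>) * norm (\<iota> v) \<le> norm (g \<tau>) * (norm (u' \<tau>) + \<epsilon>)"
              by (rule mult_left_mono) auto
            have "u' \<tau> \<bullet> (u' \<tau> - \<iota> v) \<le> norm (u' \<tau>) * norm (u' \<tau> - \<iota> v)"
              by (rule norm_cauchy_schwarz)
            also have "\<dots> \<le> M * \<epsilon>"
              using M v_near[OF \<tau>] \<tau> st by (intro mult_mono) (auto simp: norm_minus_commute)
            finally have "(norm (u' \<tau>))\<^sup>2 - M * \<epsilon> \<le> u' \<tau> \<bullet> \<iota> v"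
              by (simp add: inner_diff_right power2_norm_eq_inner)
            then have 2: "\<gamma> \<tau> * ((norm (u' \<tau>))\<^sup>2 - M * \<epsilon>) \<le> \<gamma> \<tau> * (u' \<tau> \<bullet> \<iota> v)"
              using gamma_nonneg[of \<tau>] \<tau> s0 by (intro mult_left_mono) auto
            have "\<bar>(B (u t) - B (u \<tau>)) v\<bar> \<le> norm (B (u t) - B (u \<tau>)) * norm v"
              using norm_blinfun[of "B (u t) - B (u \<tau>)" v] by simp
            also have "\<dots> \<le> \<epsilon> * norm v"
              using elim(2) st \<tau> by (intro mult_right_mono) auto
            finally have 3: "B (u t) v - \<epsilon> * norm v \<le> B (u \<tau>) v"
              by (simp add: blinfun.diff_left)
            show "norm (g \<tau>) * norm (\<iota> v) - \<gamma> \<tau> * (u' \<tau> \<bullet> \<iota> v) - B (u \<tau>) v \<le> (\<phi> \<tau> + \<epsilon> * \<psi>1 \<tau>) + c"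
              using 1 2 3 by (simp add: \<phi>_def \<psi>1_def c_def algebra_simps)
          qed (use s0 lt in auto)
          also have "\<dots> = integral {s..t} \<phi> + \<epsilon> * integral {s..t} \<psi>1 + (t - s) * c"
            using I'(1,2)[OF s0, of t] lt
            by (subst integral_add[OF _ integrable_const_ivl])
               (auto intro!: integrable_add integrable_on_mult_right simp: integral_add integrable_on_mult_right)
          also have "(t - s) * c = \<epsilon> * norm d - B (u t) d"
            using lt by (simp add: c_def d_v blinfun.scaleR_right right_diff_distrib)
          finally have A1: "(u' t - u' s) \<bullet> \<iota> v
              \<le> integral {s..t} \<phi> + \<epsilon> * integral {s..t} \<psi>1 + \<epsilon> * norm d - B (u t) d" by simp
          have "(u' t - u' s) \<bullet> (m - \<iota> v) \<le> norm (u' t - u' s) * norm (m - \<iota> v)"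
            by (rule norm_cauchy_schwarz)
          also have "\<dots> \<le> integral {s..t} (\<lambda>t. norm (u'' t)) * \<epsilon>"
            using W11_loc_deriv_norm_le[OF u'_H s0 st(2)] m_near
            by (intro mult_mono) (auto intro: order_trans[OF norm_ge_zero])
          finally have A2: "(u' t - u' s) \<bullet> (m - \<iota> v) \<le> \<epsilon> * integral {s..t} (\<lambda>t. norm (u'' t))"
            by (simp add: mult.commute)
          have A3: "\<epsilon> * norm d \<le> \<epsilon> * integral {s..t} (\<lambda>t. norm (w t))"
            using W11_loc_deriv_norm_le[OF u_V s0 st(2)] \<epsilon> by (simp add: d_def)
          have "((norm (u' t))\<^sup>2 / 2 + \<Phi> (u t)) - ((norm (u' s))\<^sup>2 / 2 + \<Phi> (u s))
              = (u' t - u' s) \<bullet> \<iota> v + (u' t - u' s) \<bullet> (m - \<iota> v) + (\<Phi> (u t) - \<Phi> (u s))"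
            by (simp add: m_def power2_norm_eq_inner algebra_simps inner_commute)
          moreover have "\<Phi> (u t) - \<Phi> (u s) \<le> B (u t) d"
            using grad_ineq[of "u t" "u s"] by (simp add: d_def blinfun.diff_right)
          moreover have "integral {s..t} \<psi> = integral {s..t} \<psi>1 + integral {s..t} (\<lambda>t. norm (u'' t))
              + integral {s..t} (\<lambda>t. norm (w t))"
            unfolding \<psi>_def using I'(2)[OF s0] u''_int_on[OF s0, THEN abs_integrable_imp_integrable]
              w_int_on[OF s0, THEN abs_integrable_imp_integrable]
            by (simp add: integral_add integrable_add)
          ultimately show ?thesis
            using A1 A2 A3 by (simp add: distrib_left)
        qed simp
      qed
    qed
  qed (use ab in auto)
  then show ?thesis by (simp add: \<phi>_def[abs_def])
qed

lemma multiplier_rate_integrable: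
  "0 \<le> a \<Longrightarrow> (\<lambda>t. (norm (u' t))\<^sup>2 + norm (\<iota> (u t - z)) * norm (g t) - B (u t) (u t - z)
      - \<gamma> t * (\<iota> (u t - z) \<bullet> u' t)) absolutely_integrable_on {a..b}"
  by (intro set_integral_diff set_integral_add absolutely_integrable_continuous_mult absolutely_integrable_continuous_real
      g_int_on continuous_intros u'_cont gamma_cont u_cont Bu_cont)

text \<open>Product rule for the pairing of \<open>u - z\<close> with \<open>u'\<close>. On a short
  interval one part tests the equation with the fixed vector \<open>u t - z\<close> of
  \<open>V\<close>; the other integrates \<open>u'\<close> against \<open>u' s\<close> and yields
  the kinetic term.\<close>

lemma multiplier_increment:
  assumes ab: "0 \<le> a" "a \<le> b"
  shows "\<iota> (u b - z) \<bullet> u' b - \<iota> (u a - z) \<bullet> u' a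
     \<le> integral {a..b} (\<lambda>t. (norm (u' t))\<^sup>2 + norm (\<iota> (u t - z)) * norm (g t) - B (u t) (u t - z)
           - \<gamma> t * (\<iota> (u t - z) \<bullet> u' t))"
proof -
  obtain M where M: "0 \<le> M" "\<And>t. t \<in> {a..b} \<Longrightarrow> norm (u' t) \<le> M"
    using bound_on_interval[OF u'_cont[OF ab(1)]] by blast
  obtain M' where M': "0 \<le> M'" "\<And>t. t \<in> {a..b} \<Longrightarrow> norm (B (u t)) \<le> M'"
    using bound_on_interval[OF Bu_cont[OF ab(1)]] by blast
  define \<phi> where "\<phi> t = norm (\<iota> (u t - z)) * norm (g t) - B (u t) (u t - z)
      - \<gamma> t * (\<iota> (u t - z) \<bullet> u' t)" for t
  \<comment> \<open>The three summands are the errors of freezing \<open>u t\<close> in the source,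
    damping and gradient terms; the \<open>M\<close> added to \<open>\<psi>\<close> below pays for
    freezing \<open>u' s\<close>.\<close>
  define \<psi> where "\<psi> t = norm (g t) + M * \<gamma> t + M'" for t
  have I1: "(\<lambda>t. (norm (u' t))\<^sup>2) absolutely_integrable_on {s..t}" if "0 \<le> s" for s t
    using that by (intro absolutely_integrable_continuous_real continuous_intros u'_cont)
  have I: "\<phi> absolutely_integrable_on {s..t}" "\<psi> absolutely_integrable_on {s..t}"  if "0 \<le> s" for s t
    unfolding \<phi>_def \<psi>_def using that
    by (intro set_integral_diff set_integral_add absolutely_integrable_continuous_mult absolutely_integrable_continuous_real
      g_int_on continuous_intros u'_cont gamma_cont u_cont Bu_cont; assumption)+
  note I' = I1[THEN abs_integrable_imp_integrable] I[THEN abs_integrable_imp_integrable]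
  have \<iota>u_cont: "continuous_on {a..b} (\<lambda>t. \<iota> (u t))"
    using ab by (intro continuous_intros u_cont)
  have "\<iota> (u b - z) \<bullet> u' b - \<iota> (u a - z) \<bullet> u' a \<le> integral {a..b} (\<lambda>t. (norm (u' t))\<^sup>2 + \<phi> t)"
  proof (rule local_increment_bound[OF ab(2), where \<psi> = "\<lambda>t. \<psi> t + M"])
    show "(\<lambda>t. (norm (u' t))\<^sup>2 + \<phi> t) integrable_on {a..b}" "(\<lambda>t. \<psi> t + M) integrable_on {a..b}"
      using I' ab by (auto intro!: integrable_add)
    fix \<epsilon> :: real assume \<epsilon>: "0 < \<epsilon>"
    show "\<forall>\<^sub>F \<delta> in at_right 0. \<forall>s t. a \<le> s \<longrightarrow> s \<le> t \<longrightarrow> t \<le> b \<longrightarrow> t - s < \<delta> \<longrightarrow>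
            \<iota> (u t - z) \<bullet> u' t - \<iota> (u s - z) \<bullet> u' s
              \<le> integral {s..t} (\<lambda>t. (norm (u' t))\<^sup>2 + \<phi> t) + \<epsilon> * integral {s..t} (\<lambda>t. \<psi> t + M)"
      using uniform_modulus[OF u'_cont[OF ab(1), of b] \<epsilon>] uniform_modulus[OF u_cont[OF ab(1), of b] \<epsilon>]
        uniform_modulus[OF \<iota>u_cont \<epsilon>]
    proof eventually_elim
      case (elim \<delta>)
      show ?case
      proof (intro allI impI)
        fix s t assume st: "a \<le> s" "s \<le> t" "t \<le> b" "t - s < \<delta>"
        with ab have s0: "0 \<le> s" by auto
        have "(u' t - u' s) \<bullet> \<iota> (u t - z) \<le> integral {s..t} (\<lambda>\<tau>. \<phi> \<tau> + \<epsilon> * \<psi> \<tau>)"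
        proof (rule weak_increment)
          show "(\<lambda>\<tau>. \<phi> \<tau> + \<epsilon> * \<psi> \<tau>) integrable_on {s..t}"
            using I'[OF s0] by (intro integrable_add integrable_on_mult_right)
          fix \<tau> assume \<tau>: "\<tau> \<in> {s..t}"
          have near: "norm (\<iota> (u t - z) - \<iota> (u \<tau> - z)) \<le> \<epsilon>"
            using elim(3) st \<tau> by (auto simp: blinfun.diff_right)
          have "norm (\<iota> (u t - z)) \<le> norm (\<iota> (u \<tau> - z)) + \<epsilon>"
            using near norm_triangle_sub[of "\<iota> (u t - z)" "\<iota> (u \<tau> - z)"] by linarith
          then have 1: "norm (g \<tau>) * norm (\<iota> (u t - z)) \<le> norm (g \<tau>) * (norm (\<iota> (u \<tau> - z)) + \<epsilon>)"
            by (rule mult_left_mono) auto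
          have "u' \<tau> \<bullet> (\<iota> (u \<tau> - z) - \<iota> (u t - z)) \<le> norm (u' \<tau>) * norm (\<iota> (u \<tau> - z) - \<iota> (u t - z))"
            by (rule norm_cauchy_schwarz)
          also have "\<dots> \<le> M * \<epsilon>"
            using M near \<tau> st by (intro mult_mono) (auto simp: norm_minus_commute)
          finally have "\<iota> (u \<tau> - z) \<bullet> u' \<tau> - M * \<epsilon> \<le> u' \<tau> \<bullet> \<iota> (u t - z)"
            by (simp add: inner_diff_right inner_commute)
          then have 2: "\<gamma> \<tau> * (\<iota> (u \<tau> - z) \<bullet> u' \<tau> - M * \<epsilon>) \<le> \<gamma> \<tau> * (u' \<tau> \<bullet> \<iota> (u t - z))"
            using gamma_nonneg[of \<tau>] \<tau> s0 by (intro mult_left_mono) auto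
          have "\<bar>B (u \<tau>) (u t - u \<tau>)\<bar> \<le> norm (B (u \<tau>)) * norm (u t - u \<tau>)"
            using norm_blinfun[of "B (u \<tau>)" "u t - u \<tau>"] by simp
          also have "\<dots> \<le> M' * \<epsilon>"
            using elim(2) st \<tau> M' by (intro mult_mono) auto
          finally have 3: "B (u \<tau>) (u \<tau> - z) - M' * \<epsilon> \<le> B (u \<tau>) (u t - z)"
            by (simp add: blinfun.diff_right)
          show "norm (g \<tau>) * norm (\<iota> (u t - z)) - \<gamma> \<tau> * (u' \<tau> \<bullet> \<iota> (u t - z)) - B (u \<tau>) (u t - z)
              \<le> \<phi> \<tau> + \<epsilon> * \<psi> \<tau>"
            using 1 2 3 by (simp add: \<phi>_def \<psi>_def algebra_simps)
        qed (use s0 st in auto)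
        also have "\<dots> = integral {s..t} \<phi> + \<epsilon> * integral {s..t} \<psi>"
          using I'[OF s0] by (simp add: integral_add integrable_on_mult_right)
        finally have A1: "(u' t - u' s) \<bullet> \<iota> (u t - z) \<le> integral {s..t} \<phi> + \<epsilon> * integral {s..t} \<psi>" .
        have hi: "((\<lambda>\<tau>. u' \<tau> \<bullet> u' s) has_integral (\<iota> (u t) - \<iota> (u s)) \<bullet> u' s) {s..t}"
          using has_integral_linear[OF W11_loc_deriv_has_integral[OF u_H s0 st(2)] bounded_linear_inner_left]
          by (simp add: o_def)
        have "integral {s..t} (\<lambda>\<tau>. u' \<tau> \<bullet> u' s) \<le> integral {s..t} (\<lambda>\<tau>. (norm (u' \<tau>))\<^sup>2 + \<epsilon> * M)"
        proof (rule integral_le[OF has_integral_integrable[OF hi]])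
          fix \<tau> assume \<tau>: "\<tau> \<in> {s..t}"
          have "u' \<tau> \<bullet> (u' s - u' \<tau>) \<le> norm (u' \<tau>) * norm (u' s - u' \<tau>)"
            by (rule norm_cauchy_schwarz)
          also have "\<dots> \<le> M * \<epsilon>"
            using elim(1) M \<tau> st by (intro mult_mono) auto
          finally show "u' \<tau> \<bullet> u' s \<le> (norm (u' \<tau>))\<^sup>2 + \<epsilon> * M"
            by (simp add: inner_diff_right power2_norm_eq_inner algebra_simps)
        qed (use I' s0 in \<open>auto intro!: integrable_add\<close>)
        then have A2: "(\<iota> (u t) - \<iota> (u s)) \<bullet> u' s \<le> integral {s..t} (\<lambda>\<tau>. (norm (u' \<tau>))\<^sup>2) + \<epsilon> * ((t - s) * M)"
          unfolding integral_unique[OF hi] integral_add[OF I'(1)[OF s0] integrable_const_ivl]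
          using st by (simp add: algebra_simps)
        have "\<iota> (u t - z) \<bullet> u' t - \<iota> (u s - z) \<bullet> u' s
            = (u' t - u' s) \<bullet> \<iota> (u t - z) + (\<iota> (u t) - \<iota> (u s)) \<bullet> u' s"
          by (simp add: blinfun.diff_right algebra_simps inner_commute)
        also have "\<dots> \<le> integral {s..t} (\<lambda>t. (norm (u' t))\<^sup>2 + \<phi> t) + \<epsilon> * integral {s..t} (\<lambda>t. \<psi> t + M)"
          using A1 A2 st
          unfolding integral_add[OF I'(1,2)[OF s0]] integral_add[OF I'(3)[OF s0] integrable_const_ivl]
          by (simp add: distrib_left)
        finally show "\<iota> (u t - z) \<bullet> u' t - \<iota> (u s - z) \<bullet> u' s \<le> \<dots>" .
      qed
    qed
  qed
  then show ?thesis by (simp add: \<phi>_def[abs_def] algebra_simps)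
qed

section \<open>The velocity measured in the dual of \<open>V\<close>\<close>

lemma dual_emb_cont: "0 \<le> a \<Longrightarrow> continuous_on {a..b} (\<lambda>t. dual_emb \<iota> (u' t))"
  unfolding dual_emb_def by (intro continuous_intros u'_cont bounded_linear.continuous_on[OF bounded_linear_blinfun_inner_right])

lemma dual_rate_integrable:
  "0 \<le> a \<Longrightarrow> (\<lambda>t. norm \<iota> * norm (g t) + norm (B (u t)) - \<gamma> t * norm (dual_emb \<iota> (u' t)))
     absolutely_integrable_on {a..b}"
  by (intro set_integral_diff set_integral_add absolutely_integrable_continuous_mult absolutely_integrable_continuous_real
      g_int_on continuous_intros dual_emb_cont gamma_cont Bu_cont)

text \<open>Testing with every \<open>v\<close> at once bounds
  \<open>dual_emb \<iota> (u' t)\<close> by a common multiple \<open>C\<close> of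
  \<open>norm v\<close>. The damping survives because it acts as a contraction by
  \<open>1 - \<Gamma>\<close> of the velocity at \<open>s\<close> instead of being estimated as an
  error.\<close>

lemma dual_increment:
  assumes ab: "0 \<le> a" "a \<le> b"
  shows "norm (dual_emb \<iota> (u' b)) - norm (dual_emb \<iota> (u' a))
     \<le> integral {a..b} (\<lambda>t. norm \<iota> * norm (g t) + norm (B (u t)) - \<gamma> t * norm (dual_emb \<iota> (u' t)))"
proof -
  define \<phi> where "\<phi> t = norm \<iota> * norm (g t) + norm (B (u t))" for t
  define N where "N t = norm (dual_emb \<iota> (u' t))" for t
  have I: "\<phi> absolutely_integrable_on {s..t}" "\<gamma> absolutely_integrable_on {s..t}"
    "(\<lambda>t. \<gamma> t * N t) absolutely_integrable_on {s..t}" if "0 \<le> s" for s t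
    unfolding \<phi>_def N_def using that
    by (intro set_integral_diff set_integral_add absolutely_integrable_continuous_mult absolutely_integrable_continuous_real
      g_int_on continuous_intros dual_emb_cont gamma_cont Bu_cont; assumption)+
  note I' = I[THEN abs_integrable_imp_integrable]
  have "N b - N a \<le> integral {a..b} (\<lambda>t. \<phi> t - \<gamma> t * N t)"
  proof (rule local_increment_bound[OF ab(2), where \<psi> = "\<lambda>t. 2 * norm \<iota> * \<gamma> t"])
    show "(\<lambda>t. \<phi> t - \<gamma> t * N t) integrable_on {a..b}" "(\<lambda>t. 2 * norm \<iota> * \<gamma> t) integrable_on {a..b}"
      using I' ab by (auto intro!: integrable_diff integrable_on_mult_right)
    fix \<epsilon> :: real assume \<epsilon>: "0 < \<epsilon>"
    show "\<forall>\<^sub>F \<delta> in at_right 0. \<forall>s t. a \<le> s \<longrightarrow> s \<le> t \<longrightarrow> t \<le> b \<longrightarrow> t - s < \<delta> \<longrightarrow>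
            N t - N s \<le> integral {s..t} (\<lambda>t. \<phi> t - \<gamma> t * N t) + \<epsilon> * integral {s..t} (\<lambda>t. 2 * norm \<iota> * \<gamma> t)"
      using uniform_modulus[OF u'_cont[OF ab(1), of b] \<epsilon>]
        uniform_modulus[OF indefinite_integral_continuous_1[OF I'(2)[OF ab(1), of b]] zero_less_one]
    proof eventually_elim
      case (elim \<delta>)
      show ?case
      proof (intro allI impI)
        fix s t assume st: "a \<le> s" "s \<le> t" "t \<le> b" "t - s < \<delta>"
        with ab have s0: "0 \<le> s" by auto
        \<comment> \<open>The modulus with tolerance 1 makes \<open>\<Gamma>\<close> at most 1, so
          that \<open>1 - \<Gamma>\<close> is a nonnegative factor.\<close>
        define \<Gamma> where "\<Gamma> = integral {s..t} \<gamma>"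
        have "integral {a..s} \<gamma> + integral {s..t} \<gamma> = integral {a..t} \<gamma>"
          by (rule Henstock_Kurzweil_Integration.integral_combine) (use st I'(2) ab in auto)
        moreover have "\<bar>integral {a..t} \<gamma> - integral {a..s} \<gamma>\<bar> \<le> 1"
          using elim(2) st by auto
        ultimately have \<Gamma>: "\<Gamma> \<le> 1" by (simp add: \<Gamma>_def)
        have near: "norm (u' s - u' \<tau>) \<le> \<epsilon>" if "\<tau> \<in> {s..t}" for \<tau>
          using elim(1) that st by auto
        \<comment> \<open>The first summand is the damped velocity at \<open>s\<close>; the last
          pays for replacing \<open>u' \<tau>\<close> by \<open>u' s\<close> under the damping
          integral.\<close>
        define C where "C = (1 - \<Gamma>) * N s + integral {s..t} \<phi> + \<epsilon> * norm \<iota> * \<Gamma>"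
        have le: "dual_emb \<iota> (u' t) v \<le> C * norm v" for v
        proof -
          have "(u' t - u' s) \<bullet> \<iota> v \<le> integral {s..t} (\<lambda>\<tau>. norm v * \<phi> \<tau> + (norm v * (\<epsilon> * norm \<iota>) - u' s \<bullet> \<iota> v) * \<gamma> \<tau>)"
          proof (rule weak_increment)
            show "(\<lambda>\<tau>. norm v * \<phi> \<tau> + (norm v * (\<epsilon> * norm \<iota>) - u' s \<bullet> \<iota> v) * \<gamma> \<tau>) integrable_on {s..t}"
              using I'[OF s0] by (intro integrable_add integrable_on_mult_right)
            fix \<tau> assume \<tau>: "\<tau> \<in> {s..t}"
            have 1: "norm (g \<tau>) * norm (\<iota> v) \<le> norm (g \<tau>) * (norm \<iota> * norm v)"
              by (intro mult_left_mono norm_blinfun) auto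
            have "(u' s - u' \<tau>) \<bullet> \<iota> v \<le> norm (u' s - u' \<tau>) * norm (\<iota> v)"
              by (rule norm_cauchy_schwarz)
            also have "\<dots> \<le> \<epsilon> * (norm \<iota> * norm v)"
              using near[OF \<tau>] norm_blinfun[of \<iota> v] \<epsilon> by (intro mult_mono) auto
            finally have "u' s \<bullet> \<iota> v - \<epsilon> * (norm \<iota> * norm v) \<le> u' \<tau> \<bullet> \<iota> v"
              by (simp add: inner_diff_left)
            then have 2: "\<gamma> \<tau> * (u' s \<bullet> \<iota> v - \<epsilon> * (norm \<iota> * norm v)) \<le> \<gamma> \<tau> * (u' \<tau> \<bullet> \<iota> v)"
              using gamma_nonneg[of \<tau>] \<tau> s0 by (intro mult_left_mono) auto
            have 3: "- B (u \<tau>) v \<le> norm (B (u \<tau>)) * norm v"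
              using norm_blinfun[of "B (u \<tau>)" v] by simp
            show "norm (g \<tau>) * norm (\<iota> v) - \<gamma> \<tau> * (u' \<tau> \<bullet> \<iota> v) - B (u \<tau>) v
               \<le> norm v * \<phi> \<tau> + (norm v * (\<epsilon> * norm \<iota>) - u' s \<bullet> \<iota> v) * \<gamma> \<tau>"
              using 1 2 3 by (simp add: \<phi>_def algebra_simps)
          qed (use s0 st in auto)
          also have "\<dots> = norm v * integral {s..t} \<phi> + (norm v * (\<epsilon> * norm \<iota>) - u' s \<bullet> \<iota> v) * \<Gamma>"
            unfolding \<Gamma>_def using I'[OF s0] by (simp add: integral_add integrable_on_mult_right)
          finally have 1: "(u' t - u' s) \<bullet> \<iota> v \<le> \<dots>" .
          have "u' s \<bullet> \<iota> v \<le> N s * norm v"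
            using norm_blinfun[of "dual_emb \<iota> (u' s)" v] by (simp add: N_def dual_emb_apply)
          then have "(1 - \<Gamma>) * (u' s \<bullet> \<iota> v) \<le> (1 - \<Gamma>) * (N s * norm v)"
            using \<Gamma> by (intro mult_left_mono) auto
          then show ?thesis
            using 1 by (simp add: dual_emb_apply C_def algebra_simps)
        qed
        have abs_le: "norm (dual_emb \<iota> (u' t) v) \<le> C * norm v" for v
          using le[of v] le[of "- v"] by (simp add: blinfun.minus_right abs_le_iff)
        have \<Gamma>0: "0 \<le> \<Gamma>"
          unfolding \<Gamma>_def using I'(2)[OF s0] gamma_nonneg s0 by (intro integral_nonneg) auto
        have "0 \<le> integral {s..t} \<phi>"
          using I'(1)[OF s0] by (intro integral_nonneg) (auto simp: \<phi>_def)
        then have "0 \<le> C"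
          unfolding C_def using \<Gamma> \<Gamma>0 \<epsilon> by (auto simp: N_def intro!: add_nonneg_nonneg mult_nonneg_nonneg)
        then have "N t \<le> C"
          unfolding N_def by (rule norm_blinfun_bound) (rule abs_le)
        \<comment> \<open>Passing between \<open>N s\<close> and \<open>N \<tau>\<close> costs
          \<open>\<epsilon> * norm \<iota> * \<Gamma>\<close> a second time, whence the factor 2 in
          the error rate.\<close>
        moreover have "integral {s..t} (\<lambda>\<tau>. \<gamma> \<tau> * N \<tau>) \<le> integral {s..t} (\<lambda>\<tau>. (N s + \<epsilon> * norm \<iota>) * \<gamma> \<tau>)"
        proof (rule integral_le)
          fix \<tau> assume \<tau>: "\<tau> \<in> {s..t}"
          have "N \<tau> - N s \<le> norm (dual_emb \<iota> (u' \<tau> - u' s))"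
            unfolding N_def dual_emb_diff by (rule norm_triangle_ineq2)
          also have "\<dots> \<le> norm \<iota> * norm (u' \<tau> - u' s)" by (rule norm_dual_emb_le)
          also have "\<dots> \<le> norm \<iota> * \<epsilon>"
            using near[OF \<tau>] by (intro mult_left_mono) (auto simp: norm_minus_commute)
          finally have "\<gamma> \<tau> * N \<tau> \<le> \<gamma> \<tau> * (N s + \<epsilon> * norm \<iota>)"
            using gamma_nonneg[of \<tau>] \<tau> s0 by (intro mult_left_mono) (auto simp: algebra_simps)
          then show "\<gamma> \<tau> * N \<tau> \<le> (N s + \<epsilon> * norm \<iota>) * \<gamma> \<tau>" by (simp add: mult.commute)
        qed (use I'[OF s0] in \<open>auto intro!: integrable_on_mult_right\<close>)
        then have "integral {s..t} (\<lambda>\<tau>. \<gamma> \<tau> * N \<tau>) \<le> (N s + \<epsilon> * norm \<iota>) * \<Gamma>"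
          by (simp add: \<Gamma>_def)
        moreover have "integral {s..t} (\<lambda>t. \<phi> t - \<gamma> t * N t) = integral {s..t} \<phi> - integral {s..t} (\<lambda>t. \<gamma> t * N t)"
          using I'[OF s0] by (simp add: integral_diff)
        moreover have \<psi>: "integral {s..t} (\<lambda>t. 2 * norm \<iota> * \<gamma> t) = 2 * norm \<iota> * \<Gamma>"
          by (simp add: \<Gamma>_def)
        ultimately show "N t - N s \<le> integral {s..t} (\<lambda>t. \<phi> t - \<gamma> t * N t) + \<epsilon> * integral {s..t} (\<lambda>t. 2 * norm \<iota> * \<gamma> t)"
          unfolding \<psi> by (simp add: C_def algebra_simps)
      qed
    qed
  qed
  then show ?thesis by (simp add: \<phi>_def N_def)
qed

end

subsection \<open>Weighted estimates\<close>

text \<open>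
  The weight \<open>q\<close> stands for \<open>(1 + t) powr \<alpha>\<close>, and \<open>T\<close> is so large that the terms with \<open>q'\<close> can be
  absorbed into the damping; this is where \<open>\<alpha> < 1\<close> enters.
\<close>

locale weighted_flow = damped_gradient_flow \<iota> B \<Phi> \<gamma> g u w u' u''
  for \<iota> :: "'v::{real_inner,banach} \<Rightarrow>\<^sub>L 'h::{real_inner,banach}"
    and B :: "'v \<Rightarrow> ('v \<Rightarrow>\<^sub>L real)"
    and \<Phi> :: "'v \<Rightarrow> real"
    and \<gamma> :: "real \<Rightarrow> real"
    and g :: "real \<Rightarrow> 'h"
    and u w :: "real \<Rightarrow> 'v"
    and u' u'' :: "real \<Rightarrow> 'h" +
  fixes q q' q'' :: "real \<Rightarrow> real" and T K R r :: real and z :: 'v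
  assumes Phi_cont: "continuous_on UNIV \<Phi>"
    and q_ge_1: "\<And>t. 0 \<le> t \<Longrightarrow> 1 \<le> q t"
    and q_deriv: "\<And>t. 0 \<le> t \<Longrightarrow> (q has_real_derivative q' t) (at t)"
    and q'_deriv: "\<And>t. 0 \<le> t \<Longrightarrow> (q' has_real_derivative q'' t) (at t)"
    and q''_cont: "\<And>a b. 0 \<le> a \<Longrightarrow> continuous_on {a..b} q''"
    and q'_nonneg: "\<And>t. 0 \<le> t \<Longrightarrow> 0 \<le> q' t"
    and q''_nonpos: "\<And>t. 0 \<le> t \<Longrightarrow> q'' t \<le> 0"
    and T: "0 \<le> T" and K: "0 < K"
    and q'_small: "\<And>t. T \<le> t \<Longrightarrow> q' t \<le> K / 6"
    and damping_lower: "\<And>t. T \<le> t \<Longrightarrow> K \<le> q t * \<gamma> t"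
    and damping_antimono: "\<And>s t. \<lbrakk>T \<le> s; s \<le> t\<rbrakk> \<Longrightarrow> q t * \<gamma> t \<le> q s * \<gamma> s"
    and qg_int: "(\<lambda>t. q t * norm (g t)) absolutely_integrable_on {0..}"
    and u_bdd: "\<And>t. 0 \<le> t \<Longrightarrow> norm (\<iota> (u t - z)) \<le> R"
    and r: "0 < r"
    and minimizers: "\<And>x y. norm y \<le> r \<Longrightarrow> \<Phi> (z + y) \<le> \<Phi> x"
begin

section \<open>Weight, energy, gap and source mass\<close>

lemma q_cont: "0 \<le> a \<Longrightarrow> continuous_on {a..b} q"
  by (rule DERIV_continuous_on[of _ _ q']) (auto intro: has_field_derivative_at_within[OF q_deriv])

lemma q'_cont: "0 \<le> a \<Longrightarrow> continuous_on {a..b} q'"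
  by (rule DERIV_continuous_on[of _ _ q'']) (auto intro: has_field_derivative_at_within[OF q'_deriv])

lemma q_nonneg: "0 \<le> t \<Longrightarrow> 0 \<le> q t"
  using q_ge_1[of t] by simp

lemma R_nonneg: "0 \<le> R"
  using u_bdd[OF order_refl] norm_ge_zero order_trans by blast

definition energy :: "real \<Rightarrow> real" where
  "energy t = (norm (u' t))\<^sup>2 / 2 + (\<Phi> (u t) - \<Phi> z)"

definition gap :: "real \<Rightarrow> real" where
  "gap t = B (u t) (u t - z)"

lemma Phi_min: "\<Phi> z \<le> \<Phi> x"
  using minimizers[of 0 x] r by simp

lemma Phi_le_gap: "\<Phi> (u t) - \<Phi> z \<le> gap t"
  using grad_ineq[of "u t" z] by (simp add: gap_def blinfun.diff_right)

lemma gap_nonneg: "0 \<le> gap t"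
  using Phi_le_gap[of t] Phi_min[of "u t"] by linarith

lemma energy_nonneg: "0 \<le> energy t"
  using Phi_min[of "u t"] by (simp add: energy_def)

text \<open>
  The only use of the interior of the set of minimizers: moving the minimizer \<open>z\<close> within a ball
  turns the scalar gap into a bound on the gradient in \<open>V'\<close>.
\<close>

lemma norm_grad_le_gap: "r * norm (B (u t)) \<le> gap t"
proof -
  have le: "B (u t) x \<le> gap t / r * norm x" for x
  proof (cases "x = 0")
    case False
    define y where "y = (r / norm x) *\<^sub>R x"
    have "norm y \<le> r" using False r by (simp add: y_def)
    then have "\<Phi> (z + y) \<le> \<Phi> (u t)" by (rule minimizers)
    then have "B (u t) y \<le> gap t"
      using grad_ineq[of "u t" "z + y"] by (simp add: gap_def blinfun.diff_right blinfun.add_right)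
    then show ?thesis
      using False r by (simp add: y_def blinfun.scaleR_right field_simps)
  qed simp
  have "norm (B (u t) x) \<le> gap t / r * norm x" for x
    using le[of x] le[of "- x"] by (simp add: blinfun.minus_right abs_le_iff)
  then have "norm (B (u t)) \<le> gap t / r"
    using gap_nonneg r by (intro norm_blinfun_bound) auto
  then show ?thesis using r by (simp add: field_simps)
qed

lemma energy_cont: "0 \<le> a \<Longrightarrow> continuous_on {a..b} energy"
  unfolding energy_def
  by (intro continuous_intros u'_cont continuous_on_compose2[OF Phi_cont u_cont]) auto

lemma gap_cont: "0 \<le> a \<Longrightarrow> continuous_on {a..b} gap"
  unfolding gap_def by (intro continuous_intros Bu_cont u_cont)

lemmas integrable_facts = absolutely_integrable_continuous_mult absolutely_integrable_continuous_real
  continuous_intros q_cont q'_cont q''_cont u'_cont u_cont gamma_cont Bu_cont dual_emb_cont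
  gap_cont energy_cont g_int_on

lemma qg_int_on: "0 \<le> a \<Longrightarrow> (\<lambda>t. q t * norm (g t)) absolutely_integrable_on {a..b}"
  by (rule absolutely_integrable_on_subinterval[OF qg_int]) auto

definition source_mass :: real where
  "source_mass = integral {0..} (\<lambda>t. q t * norm (g t))"

lemma weighted_source_le_mass: "0 \<le> a \<Longrightarrow> integral {a..b} (\<lambda>t. q t * norm (g t)) \<le> source_mass"
  unfolding source_mass_def
  by (intro integral_subset_le abs_integrable_imp_integrable[OF qg_int]
      abs_integrable_imp_integrable[OF qg_int_on]) (auto simp: q_nonneg)

lemma source_mass_nonneg: "0 \<le> source_mass"
  unfolding source_mass_def
  by (intro integral_nonneg abs_integrable_imp_integrable[OF qg_int]) (simp add: q_nonneg)

section \<open>Weighted energy and multiplier estimates\<close>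

lemma weighted_energy_increment:
  assumes b: "T \<le> b"
  shows "(q b)\<^sup>2 * energy b - (q T)\<^sup>2 * energy T
    \<le> integral {T..b} (\<lambda>t. energy t * (2 * q t * q' t)
          + (q t)\<^sup>2 * (norm (u' t) * norm (g t) - \<gamma> t * (norm (u' t))\<^sup>2))"
proof (rule weighted_increment_bound[OF b])
  show "continuous_on {T..b} (\<lambda>t. (q t)\<^sup>2)" "continuous_on {T..b} energy"
    "(\<lambda>t. 2 * q t * q' t) absolutely_integrable_on {T..b}"
    by (intro integrable_facts T | simp)+
  show "(\<lambda>t. norm (u' t) * norm (g t) - \<gamma> t * (norm (u' t))\<^sup>2) absolutely_integrable_on {T..b}"
    by (rule energy_rate_integrable[OF T])
  fix s t assume st: "T \<le> s" "s \<le> t" "t \<le> b"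
  then have s0: "0 \<le> s" using T by simp
  show "energy t - energy s \<le> integral {s..t} (\<lambda>t. norm (u' t) * norm (g t) - \<gamma> t * (norm (u' t))\<^sup>2)"
    using energy_increment[OF s0 st(2)] by (simp add: energy_def)
  have "((\<lambda>t. 2 * q t * q' t) has_integral ((q t)\<^sup>2 - (q s)\<^sup>2)) {s..t}"
    using st s0 q_deriv by (intro has_integral_real_derivative) (auto intro!: derivative_eq_intros)
  then show "((q t)\<^sup>2 - (q s)\<^sup>2) * energy s \<le> integral {s..t} (\<lambda>t. 2 * q t * q' t) * energy s"
    by (simp add: integral_unique)
qed auto

text \<open>\<open>u'\<close> is continuous into \<open>H\<close>, so \<open>\<iota> (u - z)\<close>
  is classically differentiable and the chain rule for half the squared norm holds at every
  point.\<close>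

lemma half_square_increment:
  assumes st: "0 \<le> s" "s \<le> t"
  shows "((\<lambda>\<tau>. \<iota> (u \<tau> - z) \<bullet> u' \<tau>) has_integral
     ((norm (\<iota> (u t - z)))\<^sup>2 / 2 - (norm (\<iota> (u s - z)))\<^sup>2 / 2)) {s..t}"
proof (rule fundamental_theorem_of_calculus[OF st(2)])
  fix \<tau> assume \<tau>: "\<tau> \<in> {s..t}"
  have eq: "\<iota> (u x - z) = integral {s..x} u' + \<iota> (u s - z)" if "x \<in> {s..t}" for x
    using integral_unique[OF W11_loc_deriv_has_integral[OF u_H st(1), of x]] that
    by (simp add: blinfun.diff_right)
  have "((\<lambda>x. integral {s..x} u' + \<iota> (u s - z)) has_vector_derivative u' \<tau>) (at \<tau> within {s..t})"
    by (rule derivative_eq_intros integral_has_vector_derivative[OF u'_cont[OF st(1)] \<tau>] refl)+ simp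
  then have "((\<lambda>x. \<iota> (u x - z)) has_vector_derivative u' \<tau>) (at \<tau> within {s..t})"
    by (rule has_vector_derivative_transform[OF \<tau> eq, rotated])
  from has_derivative_inner[OF this[unfolded has_vector_derivative_def] this[unfolded has_vector_derivative_def]]
  have "((\<lambda>x. \<iota> (u x - z) \<bullet> \<iota> (u x - z)) has_vector_derivative 2 * (\<iota> (u \<tau> - z) \<bullet> u' \<tau>)) (at \<tau> within {s..t})"
    by (simp add: has_vector_derivative_def inner_commute algebra_simps)
  from has_vector_derivative_mult_right[OF this, of "1/2"]
  show "((\<lambda>t. (norm (\<iota> (u t - z)))\<^sup>2 / 2) has_vector_derivative \<iota> (u \<tau> - z) \<bullet> u' \<tau>) (at \<tau> within {s..t})"
    by (simp add: power2_norm_eq_inner)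
qed

text \<open>The weighted gap is controlled by the kinetic integral up to a boundary term linear in
  the velocity; that term is harmless because \<open>combined_estimate\<close> controls the velocity
  quadratically.\<close>

lemma weighted_multiplier_increment:
  obtains C where "0 \<le> C"
    "\<And>b. T \<le> b \<Longrightarrow> integral {T..b} (\<lambda>t. q t * gap t)
        \<le> C + R * (q b * norm (u' b)) + integral {T..b} (\<lambda>t. q t * (norm (u' t))\<^sup>2)"
proof -
  define D where "D t = \<iota> (u t - z) \<bullet> u' t" for t
  define p where "p t = (norm (\<iota> (u t - z)))\<^sup>2 / 2" for t
  \<comment> \<open>With \<open>p' = D\<close>, adding \<open>(c p)'\<close> to \<open>(q D)'\<close> cancels every term that contains \<open>D\<close>.\<close>
  define c where "c t = q t * \<gamma> t - q' t" for t
  define \<phi> where "\<phi> t = (norm (u' t))\<^sup>2 + norm (\<iota> (u t - z)) * norm (g t) - B (u t) (u t - z)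
           - \<gamma> t * (\<iota> (u t - z) \<bullet> u' t)" for t
  define C where "C = \<bar>q T * D T + c T * p T\<bar> + R\<^sup>2 / 2 * q' T + R * source_mass"
  have c0: "0 \<le> c t" if "T \<le> t" for t
    using damping_lower[OF that] q'_small[OF that] K by (simp add: c_def)
  have cont: "continuous_on {a..b} D" "continuous_on {a..b} p" "continuous_on {a..b} c" if "0 \<le> a" for a b
    unfolding D_def p_def c_def by (intro integrable_facts that | simp)+
  have \<phi>_int: "\<phi> absolutely_integrable_on {a..b}" if "0 \<le> a" for a b
    unfolding \<phi>_def by (rule multiplier_rate_integrable[OF that])
  have main: "integral {T..b} (\<lambda>t. q t * gap t)
        \<le> C + R * (q b * norm (u' b)) + integral {T..b} (\<lambda>t. q t * (norm (u' t))\<^sup>2)" if b: "T \<le> b" for b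
  proof -
    have b0: "0 \<le> b" using b T by simp
    have 1: "q b * D b - q T * D T \<le> integral {T..b} (\<lambda>t. D t * q' t + q t * \<phi> t)"
    proof (rule weighted_increment_bound[OF b q_cont[OF T] _ cont(1)[OF T] \<phi>_int[OF T]])
      show "q' absolutely_integrable_on {T..b}"
        using T by (intro integrable_facts)
      fix s t assume st: "T \<le> s" "s \<le> t" "t \<le> b"
      then have s0: "0 \<le> s" using T by simp
      show "D t - D s \<le> integral {s..t} \<phi>"
        unfolding D_def \<phi>_def by (rule multiplier_increment[OF s0 st(2)])
      show "(q t - q s) * D s \<le> integral {s..t} q' * D s"
        using has_integral_real_derivative[of s t q q'] q_deriv st s0 by (simp add: integral_unique)
    qed (use T q_nonneg in auto)
    \<comment> \<open>Only an upper bound on the increments of \<open>c\<close> is available, from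
      the monotonicity of \<open>q t * \<gamma> t\<close>; it suffices because \<open>p\<close> is
      nonnegative.\<close>
    have 2: "c b * p b - c T * p T \<le> integral {T..b} (\<lambda>t. p t * - q'' t + c t * D t)"
    proof (rule weighted_increment_bound[OF b cont(3)[OF T] _ cont(2)[OF T]])
      show "D absolutely_integrable_on {T..b}"
        using cont T by (intro absolutely_integrable_continuous_real) auto
      show "(\<lambda>t. - q'' t) absolutely_integrable_on {T..b}"
        using T by (intro integrable_facts)
      fix s t assume st: "T \<le> s" "s \<le> t" "t \<le> b"
      then have s0: "0 \<le> s" using T by simp
      show "p t - p s \<le> integral {s..t} D"
        using integral_unique[OF half_square_increment[OF s0 st(2)]] by (simp add: D_def[abs_def] p_def)
      have "c t - c s \<le> - (q' t - q' s)"
        using damping_antimono[OF st(1,2)] by (simp add: c_def)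
      also have "\<dots> = integral {s..t} (\<lambda>t. - q'' t)"
        using has_integral_real_derivative[of s t q' q''] q'_deriv st s0 by (simp add: integral_unique)
      finally show "(c t - c s) * p s \<le> integral {s..t} (\<lambda>t. - q'' t) * p s"
        by (rule mult_right_mono) (simp add: p_def)
    qed (use c0 in auto)
    have I: "(\<lambda>t. D t * q' t + q t * \<phi> t) integrable_on {T..b}" "(\<lambda>t. p t * - q'' t + c t * D t) integrable_on {T..b}"
      "(\<lambda>t. q t * (norm (u' t))\<^sup>2) integrable_on {T..b}" "(\<lambda>t. q t * norm (g t)) integrable_on {T..b}"
      "(\<lambda>t. q t * gap t) integrable_on {T..b}" "(\<lambda>t. - q'' t) integrable_on {T..b}"
      by (intro abs_integrable_imp_integrable set_integral_add integrable_facts cont \<phi>_int T)+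
    have "q b * D b + c b * p b - (q T * D T + c T * p T)
        \<le> integral {T..b} (\<lambda>t. (D t * q' t + q t * \<phi> t) + (p t * - q'' t + c t * D t))"
      using 1 2 by (simp only: integral_add[OF I(1,2)])
    also have "\<dots> \<le> integral {T..b} (\<lambda>t. (q t * (norm (u' t))\<^sup>2 + R * (q t * norm (g t)) + R\<^sup>2 / 2 * - q'' t) - q t * gap t)"
    proof (rule integral_le)
      fix t assume t: "t \<in> {T..b}"
      then have t0: "0 \<le> t" using T by auto
      have "norm (\<iota> (u t - z)) * (q t * norm (g t)) \<le> R * (q t * norm (g t))"
        using u_bdd[OF t0] q_nonneg[OF t0] by (intro mult_right_mono) auto
      moreover have "p t * - q'' t \<le> R\<^sup>2 / 2 * - q'' t"
        unfolding p_def using u_bdd[OF t0] q''_nonpos[OF t0]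
        by (intro mult_right_mono divide_right_mono power_mono) auto
      ultimately show "(D t * q' t + q t * \<phi> t) + (p t * - q'' t + c t * D t)
         \<le> (q t * (norm (u' t))\<^sup>2 + R * (q t * norm (g t)) + R\<^sup>2 / 2 * - q'' t) - q t * gap t"
        by (simp add: \<phi>_def c_def gap_def D_def algebra_simps)
    qed (rule integrable_add[OF I(1,2)], intro integrable_diff integrable_add integrable_on_mult_right I)
    also have "\<dots> = integral {T..b} (\<lambda>t. q t * (norm (u' t))\<^sup>2) + R * integral {T..b} (\<lambda>t. q t * norm (g t))
        + R\<^sup>2 / 2 * integral {T..b} (\<lambda>t. - q'' t) - integral {T..b} (\<lambda>t. q t * gap t)"
    proof -
      note I2 = integrable_on_mult_right[OF I(4), of R] integrable_on_mult_right[OF I(6), of "R\<^sup>2 / 2"]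
      show ?thesis
        unfolding integral_diff[OF integrable_add[OF integrable_add[OF I(3) I2(1)] I2(2)] I(5)]
          integral_add[OF integrable_add[OF I(3) I2(1)] I2(2)] integral_add[OF I(3) I2(1)]
          integral_mult_right ..
    qed
    finally have 3: "q b * D b + c b * p b - (q T * D T + c T * p T) \<le> \<dots>" .
    have "R * integral {T..b} (\<lambda>t. q t * norm (g t)) \<le> R * source_mass"
      by (intro mult_left_mono weighted_source_le_mass T R_nonneg)
    \<comment> \<open>\<open>- q''\<close> integrates to \<open>q' T - q' b\<close>, and
      \<open>q' b\<close> is nonnegative.\<close>
    moreover have "R\<^sup>2 / 2 * integral {T..b} (\<lambda>t. - q'' t) \<le> R\<^sup>2 / 2 * q' T"
      using has_integral_real_derivative[of T b q' q''] q'_deriv b T q'_nonneg[OF b0]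
      by (intro mult_left_mono) (auto simp: integral_unique)
    moreover have "0 \<le> c b * p b"
      using c0[OF b] by (simp add: p_def)
    moreover have "- (R * (q b * norm (u' b))) \<le> q b * D b"
    proof -
      have "\<bar>D b\<bar> \<le> norm (\<iota> (u b - z)) * norm (u' b)"
        unfolding D_def by (rule Cauchy_Schwarz_ineq2)
      also have "\<dots> \<le> R * norm (u' b)"
        by (intro mult_right_mono u_bdd b0) auto
      finally have "q b * - (R * norm (u' b)) \<le> q b * D b"
        using q_nonneg[OF b0] by (intro mult_left_mono) auto
      then show ?thesis by (simp add: algebra_simps)
    qed
    ultimately show ?thesis
      using 3 abs_ge_self[of "q T * D T + c T * p T"] unfolding C_def by linarith
  qed
  have "0 \<le> C"
    unfolding C_def using q'_nonneg[OF T] R_nonneg source_mass_nonneg by simp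
  then show ?thesis using main that by blast
qed

text \<open>Since \<open>2 * q' t \<le> K / 3\<close>, the growth of the weight costs
  \<open>K / 6\<close> of the damping constant \<open>K\<close> and \<open>K / 3\<close> times the
  weighted gap. The multiplier estimate turns the latter into another \<open>K / 3\<close> of the
  kinetic integral, so \<open>K / 2\<close> survives. \<open>M\<close> stays free so that it can
  later be an attained maximum.\<close>

lemma combined_estimate:
  obtains C1 C2 where "0 \<le> C1" "0 \<le> C2"
    "\<And>b M. \<lbrakk>T \<le> b; \<And>t. t \<in> {T..b} \<Longrightarrow> q t * norm (u' t) \<le> M\<rbrakk> \<Longrightarrow>
       (q b * norm (u' b))\<^sup>2 / 2 + K / 2 * integral {T..b} (\<lambda>t. q t * (norm (u' t))\<^sup>2)
         \<le> C1 + C2 * (q b * norm (u' b)) + source_mass * M"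
proof -
  obtain C where C: "0 \<le> C" "\<And>b. T \<le> b \<Longrightarrow> integral {T..b} (\<lambda>t. q t * gap t)
        \<le> C + R * (q b * norm (u' b)) + integral {T..b} (\<lambda>t. q t * (norm (u' t))\<^sup>2)"
    using weighted_multiplier_increment by blast
  show ?thesis
  proof (rule that)
    show "0 \<le> (q T)\<^sup>2 * energy T + K / 3 * C" "0 \<le> K / 3 * R"
      using C(1) K R_nonneg energy_nonneg by auto
    fix b M assume b: "T \<le> b" and M: "\<And>t. t \<in> {T..b} \<Longrightarrow> q t * norm (u' t) \<le> M"
    have I: "(\<lambda>t. q t * (norm (u' t))\<^sup>2) integrable_on {T..b}" "(\<lambda>t. q t * norm (g t)) integrable_on {T..b}"
      "(\<lambda>t. q t * gap t) integrable_on {T..b}"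
      "(\<lambda>t. energy t * (2 * q t * q' t)
          + (q t)\<^sup>2 * (norm (u' t) * norm (g t) - \<gamma> t * (norm (u' t))\<^sup>2)) integrable_on {T..b}"
      by (intro abs_integrable_imp_integrable set_integral_add integrable_facts energy_rate_integrable T)+
    define J where "J = integral {T..b} (\<lambda>t. q t * (norm (u' t))\<^sup>2)"
    have "(q b)\<^sup>2 * energy b - (q T)\<^sup>2 * energy T
      \<le> integral {T..b} (\<lambda>t. energy t * (2 * q t * q' t)
            + (q t)\<^sup>2 * (norm (u' t) * norm (g t) - \<gamma> t * (norm (u' t))\<^sup>2))"
      by (rule weighted_energy_increment[OF b])
    also have "\<dots> \<le> integral {T..b} (\<lambda>t. K / 3 * (q t * gap t) + M * (q t * norm (g t)) - 5 * K / 6 * (q t * (norm (u' t))\<^sup>2))"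
    proof (rule integral_le[OF I(4)])
      show "(\<lambda>t. K / 3 * (q t * gap t) + M * (q t * norm (g t)) - 5 * K / 6 * (q t * (norm (u' t))\<^sup>2)) integrable_on {T..b}"
        by (intro integrable_diff integrable_add integrable_on_mult_right I)
      fix t assume t: "t \<in> {T..b}"
      then have t0: "0 \<le> t" using T by auto
      have "energy t * q t * (2 * q' t) \<le> energy t * q t * (K / 3)"
        using q'_small[of t] t energy_nonneg[of t] q_nonneg[OF t0] by (intro mult_left_mono) auto
      moreover have "energy t * q t \<le> ((norm (u' t))\<^sup>2 / 2 + gap t) * q t"
        unfolding energy_def using Phi_le_gap[of t] q_nonneg[OF t0] by (intro mult_right_mono) auto
      then have "energy t * q t * (K / 3) \<le> ((norm (u' t))\<^sup>2 / 2 + gap t) * q t * (K / 3)"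
        by (rule mult_right_mono) (use K in simp)
      moreover have "(q t * norm (u' t)) * (q t * norm (g t)) \<le> M * (q t * norm (g t))"
        using M[OF t] q_nonneg[OF t0] by (intro mult_right_mono) auto
      moreover have "K * (q t * (norm (u' t))\<^sup>2) \<le> q t * \<gamma> t * (q t * (norm (u' t))\<^sup>2)"
        using damping_lower[of t] t q_nonneg[OF t0] by (intro mult_right_mono) auto
      ultimately show "energy t * (2 * q t * q' t) + (q t)\<^sup>2 * (norm (u' t) * norm (g t) - \<gamma> t * (norm (u' t))\<^sup>2)
         \<le> K / 3 * (q t * gap t) + M * (q t * norm (g t)) - 5 * K / 6 * (q t * (norm (u' t))\<^sup>2)"
        by (simp add: algebra_simps power2_eq_square)
    qed
    also have "\<dots> = K / 3 * integral {T..b} (\<lambda>t. q t * gap t) + M * integral {T..b} (\<lambda>t. q t * norm (g t)) - 5 * K / 6 * J"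
    proof -
      note I2 = integrable_on_mult_right[OF I(3), of "K / 3"] integrable_on_mult_right[OF I(2), of M]
        integrable_on_mult_right[OF I(1), of "5 * K / 6"]
      show ?thesis
        unfolding integral_diff[OF integrable_add[OF I2(1,2)] I2(3)] integral_add[OF I2(1,2)]
          integral_mult_right J_def ..
    qed
    also have "\<dots> \<le> K / 3 * (C + R * (q b * norm (u' b)) + J) + M * source_mass - 5 * K / 6 * J"
    proof -
      have "0 \<le> M"
        using M[of T] b q_nonneg[OF T] by (auto intro: order_trans[rotated])
      then show ?thesis
        unfolding J_def using K C(2)[OF b] weighted_source_le_mass[OF T, of b]
        by (intro diff_right_mono add_mono mult_left_mono) auto
    qed
    finally have "(q b)\<^sup>2 * energy b - (q T)\<^sup>2 * energy T
       \<le> K / 3 * (C + R * (q b * norm (u' b)) + J) + M * source_mass - 5 * K / 6 * J" .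
    moreover have "(q b * norm (u' b))\<^sup>2 / 2 \<le> (q b)\<^sup>2 * energy b"
    proof -
      have "(q b)\<^sup>2 * ((norm (u' b))\<^sup>2 / 2) \<le> (q b)\<^sup>2 * energy b"
        unfolding energy_def using Phi_min[of "u b"] by (intro mult_left_mono) auto
      then show ?thesis by (simp add: power_mult_distrib)
    qed
    ultimately show "(q b * norm (u' b))\<^sup>2 / 2 + K / 2 * integral {T..b} (\<lambda>t. q t * (norm (u' t))\<^sup>2)
         \<le> ((q T)\<^sup>2 * energy T + K / 3 * C) + K / 3 * R * (q b * norm (u' b)) + source_mass * M"
      unfolding J_def[symmetric] by (simp add: algebra_simps)
  qed
qed

text \<open>At a maximum point \<open>m\<close> of the weighted speed, the bound \<open>M\<close>
  may be the value \<open>X\<close> itself, and the estimate becomes a quadratic inequality that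
  bounds \<open>X\<close> independently of \<open>b\<close>.\<close>

lemma weighted_velocity_bounded:
  obtains M where "\<And>t. T \<le> t \<Longrightarrow> q t * norm (u' t) \<le> M"
proof -
  obtain C1 C2 where C: "0 \<le> C1" "0 \<le> C2"
    and est: "\<And>b M. \<lbrakk>T \<le> b; \<And>t. t \<in> {T..b} \<Longrightarrow> q t * norm (u' t) \<le> M\<rbrakk> \<Longrightarrow>
       (q b * norm (u' b))\<^sup>2 / 2 + K / 2 * integral {T..b} (\<lambda>t. q t * (norm (u' t))\<^sup>2)
         \<le> C1 + C2 * (q b * norm (u' b)) + source_mass * M"
    using combined_estimate by blast
  show ?thesis
  proof (rule that)
    fix b assume b: "T \<le> b"
    have "continuous_on {T..b} (\<lambda>t. q t * norm (u' t))"
      using T by (intro integrable_facts)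
    then obtain m where m: "m \<in> {T..b}" "\<And>t. t \<in> {T..b} \<Longrightarrow> q t * norm (u' t) \<le> q m * norm (u' m)"
      using continuous_attains_sup[of "{T..b}" "\<lambda>t. q t * norm (u' t)"] b by auto
    define X where "X = q m * norm (u' m)"
    have "0 \<le> K / 2 * integral {T..m} (\<lambda>t. q t * (norm (u' t))\<^sup>2)"
      using K T q_nonneg by (intro mult_nonneg_nonneg integral_nonneg abs_integrable_imp_integrable integrable_facts) auto
    then have X: "X\<^sup>2 / 2 \<le> C1 + C2 * X + source_mass * X"
      using est[of m X] m by (auto simp: X_def)
    \<comment> \<open>If \<open>X\<close> exceeds 1, then \<open>C1\<close> is at most
      \<open>C1 * X\<close> and a factor \<open>X\<close> cancels.\<close>
    have "X \<le> 1 + 2 * (C1 + C2 + source_mass)"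
    proof (cases "X \<le> 1")
      case False
      then have "C1 \<le> C1 * X" using C(1) by (simp add: mult_le_cancel_left1)
      with X have "X * X \<le> X * (2 * (C1 + C2 + source_mass))"
        by (simp add: power2_eq_square algebra_simps)
      with False show ?thesis by simp
    qed (use C source_mass_nonneg in simp)
    then show "q b * norm (u' b) \<le> 1 + 2 * (C1 + C2 + source_mass)"
      using m(2)[of b] b by (simp add: X_def)
  qed
qed

text \<open>With the velocity bound inserted, the right-hand sides of the two preceding estimates no
  longer depend on \<open>b\<close>.\<close>

lemma weighted_integrals_bounded:
  obtains C where "\<And>b. T \<le> b \<Longrightarrow> integral {T..b} (\<lambda>t. q t * (norm (u' t))\<^sup>2) \<le> C"
    "\<And>b. T \<le> b \<Longrightarrow> integral {T..b} (\<lambda>t. q t * gap t) \<le> C"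
proof -
  obtain M where M: "\<And>t. T \<le> t \<Longrightarrow> q t * norm (u' t) \<le> M"
    using weighted_velocity_bounded by blast
  obtain C1 C2 where C: "0 \<le> C1" "0 \<le> C2"
    and est: "\<And>b M. \<lbrakk>T \<le> b; \<And>t. t \<in> {T..b} \<Longrightarrow> q t * norm (u' t) \<le> M\<rbrakk> \<Longrightarrow>
       (q b * norm (u' b))\<^sup>2 / 2 + K / 2 * integral {T..b} (\<lambda>t. q t * (norm (u' t))\<^sup>2)
         \<le> C1 + C2 * (q b * norm (u' b)) + source_mass * M"
    using combined_estimate by blast
  obtain C3 where C3: "0 \<le> C3" "\<And>b. T \<le> b \<Longrightarrow> integral {T..b} (\<lambda>t. q t * gap t)
        \<le> C3 + R * (q b * norm (u' b)) + integral {T..b} (\<lambda>t. q t * (norm (u' t))\<^sup>2)"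
    using weighted_multiplier_increment by blast
  define C4 where "C4 = 2 / K * (C1 + C2 * M + source_mass * M)"
  have J: "integral {T..b} (\<lambda>t. q t * (norm (u' t))\<^sup>2) \<le> C4" if b: "T \<le> b" for b
  proof -
    have "C2 * (q b * norm (u' b)) \<le> C2 * M"
      by (intro mult_left_mono M b C)
    moreover have "(q b * norm (u' b))\<^sup>2 / 2 + K / 2 * integral {T..b} (\<lambda>t. q t * (norm (u' t))\<^sup>2)
         \<le> C1 + C2 * (q b * norm (u' b)) + source_mass * M"
      by (rule est[OF b]) (simp add: M)
    ultimately have "K / 2 * integral {T..b} (\<lambda>t. q t * (norm (u' t))\<^sup>2) \<le> C1 + C2 * M + source_mass * M"
      using zero_le_power2[of "q b * norm (u' b)"] by linarith
    then show ?thesis using K by (simp add: C4_def field_simps)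
  qed
  have M0: "0 \<le> M"
    using M[of T] q_nonneg[OF T] by (auto intro: order_trans[rotated])
  show ?thesis
  proof (rule that)
    fix b assume b: "T \<le> b"
    show "integral {T..b} (\<lambda>t. q t * (norm (u' t))\<^sup>2) \<le> C3 + R * M + C4"
      using J[OF b] C3(1) R_nonneg M0 by (intro order_trans[OF J[OF b]]) auto
    have "R * (q b * norm (u' b)) \<le> R * M"
      by (intro mult_left_mono M b R_nonneg)
    then show "integral {T..b} (\<lambda>t. q t * gap t) \<le> C3 + R * M + C4"
      using C3(2)[OF b] J[OF b] by linarith
  qed
qed

section \<open>Finite length of the trajectory in the dual\<close>

text \<open>In \<open>dual_increment\<close> with the weight \<open>q\<close>, the growth of the
  weight uses up \<open>K / 6\<close> of the damping and leaves \<open>5 * K / 6\<close>. The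
  weighted source and gradient norm have bounded integrals, the latter through the gap divided by
  \<open>r\<close>.\<close>

lemma dual_velocity_integrable:
  obtains C where "\<And>b. T \<le> b \<Longrightarrow> integral {T..b} (\<lambda>t. norm (dual_emb \<iota> (u' t))) \<le> C"
proof -
  obtain C where "\<And>b. T \<le> b \<Longrightarrow> integral {T..b} (\<lambda>t. q t * (norm (u' t))\<^sup>2) \<le> C"
    and C: "\<And>b. T \<le> b \<Longrightarrow> integral {T..b} (\<lambda>t. q t * gap t) \<le> C"
    using weighted_integrals_bounded by blast
  define N where "N t = norm (dual_emb \<iota> (u' t))" for t
  define \<phi> where "\<phi> t = norm \<iota> * norm (g t) + norm (B (u t)) - \<gamma> t * N t" for t
  have \<phi>: "\<phi> absolutely_integrable_on {a..b}" if "0 \<le> a" for a b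
    unfolding \<phi>_def N_def by (rule dual_rate_integrable[OF that])
  have N_cont: "continuous_on {a..b} N" if "0 \<le> a" for a b
    unfolding N_def using that by (intro integrable_facts)
  have "integral {T..b} N \<le> (6 / (5 * K)) * (q T * N T + norm \<iota> * source_mass + C / r)" if b: "T \<le> b" for b
  proof -
    have q\<phi>: "(\<lambda>t. N t * q' t + q t * \<phi> t) absolutely_integrable_on {T..b}"
      by (rule set_integral_add(1)[OF absolutely_integrable_continuous_mult[OF N_cont[OF T]]
            absolutely_integrable_continuous_mult[OF q_cont[OF T] \<phi>[OF T]]])
         (intro absolutely_integrable_continuous_real q'_cont T)
    have I: "(\<lambda>t. N t * q' t + q t * \<phi> t) integrable_on {T..b}" "(\<lambda>t. q t * norm (g t)) integrable_on {T..b}"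
      "(\<lambda>t. q t * gap t) integrable_on {T..b}" "N integrable_on {T..b}"
      by (intro abs_integrable_imp_integrable q\<phi> qg_int_on T
          absolutely_integrable_continuous_real continuous_on_mult q_cont gap_cont N_cont)+
    have "q b * N b - q T * N T \<le> integral {T..b} (\<lambda>t. N t * q' t + q t * \<phi> t)"
    proof (rule weighted_increment_bound[OF b q_cont[OF T] _ N_cont[OF T] \<phi>[OF T]])
      show "q' absolutely_integrable_on {T..b}"
        using T by (intro integrable_facts)
      fix s t assume st: "T \<le> s" "s \<le> t" "t \<le> b"
      then have s0: "0 \<le> s" using T by simp
      show "N t - N s \<le> integral {s..t} \<phi>"
        unfolding N_def \<phi>_def by (rule dual_increment[OF s0 st(2)])
      show "(q t - q s) * N s \<le> integral {s..t} q' * N s"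
        using has_integral_real_derivative[of s t q q'] q_deriv st s0 by (simp add: integral_unique)
    qed (use T q_nonneg in auto)
    also have "\<dots> \<le> integral {T..b} (\<lambda>t. norm \<iota> * (q t * norm (g t)) + 1 / r * (q t * gap t) - 5 * K / 6 * N t)"
    proof (rule integral_le[OF I(1)])
      show "(\<lambda>t. norm \<iota> * (q t * norm (g t)) + 1 / r * (q t * gap t) - 5 * K / 6 * N t) integrable_on {T..b}"
        by (intro integrable_diff integrable_add integrable_on_mult_right I)
      fix t assume t: "t \<in> {T..b}"
      then have t0: "0 \<le> t" using T by auto
      have "N t * q' t \<le> N t * (K / 6)"
        using q'_small[of t] t by (intro mult_left_mono) (auto simp: N_def)
      moreover have "norm (B (u t)) \<le> 1 / r * gap t"
        using norm_grad_le_gap[of t] r by (simp add: field_simps)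
      then have "q t * norm (B (u t)) \<le> q t * (1 / r * gap t)"
        using q_nonneg[OF t0] by (rule mult_left_mono)
      moreover have "K * N t \<le> q t * \<gamma> t * N t"
        using damping_lower[of t] t by (intro mult_right_mono) (auto simp: N_def)
      ultimately show "N t * q' t + q t * \<phi> t \<le> norm \<iota> * (q t * norm (g t)) + 1 / r * (q t * gap t) - 5 * K / 6 * N t"
        by (simp add: \<phi>_def algebra_simps)
    qed
    also have "\<dots> = norm \<iota> * integral {T..b} (\<lambda>t. q t * norm (g t)) + 1 / r * integral {T..b} (\<lambda>t. q t * gap t)
        - 5 * K / 6 * integral {T..b} N"
    proof -
      note I2 = integrable_on_mult_right[OF I(2), of "norm \<iota>"] integrable_on_mult_right[OF I(3), of "1 / r"]
        integrable_on_mult_right[OF I(4), of "5 * K / 6"]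
      show ?thesis
        unfolding integral_diff[OF integrable_add[OF I2(1,2)] I2(3)] integral_add[OF I2(1,2)]
          integral_mult_right ..
    qed
    also have "\<dots> \<le> norm \<iota> * source_mass + 1 / r * C - 5 * K / 6 * integral {T..b} N"
      using r by (intro diff_right_mono add_mono mult_left_mono weighted_source_le_mass[OF T] C[OF b]) auto
    finally have "5 * K / 6 * integral {T..b} N \<le> q T * N T - q b * N b + norm \<iota> * source_mass + C / r"
      using mult_1_left[of "C / r"] by (simp only: times_divide_eq_left mult_1_left)
    moreover have "0 \<le> q b * N b"
      using q_nonneg[of b] b T by (simp add: N_def)
    ultimately show ?thesis
      using K by (simp add: field_simps)
  qed
  then show ?thesis
    by (rule that[unfolded N_def[symmetric]])
qed

text \<open>The increment of \<open>\<iota> (u t)\<close> is the integral of \<open>u'\<close>, so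
  the small tails of the dual speed control it.\<close>

lemma dual_Cauchy:
  assumes "0 < \<epsilon>"
  obtains S where "\<And>s t. \<lbrakk>S \<le> s; s \<le> t\<rbrakk> \<Longrightarrow> norm (dual_emb \<iota> (\<iota> (u t - u s))) \<le> \<epsilon>"
proof -
  obtain C where C: "\<And>b. T \<le> b \<Longrightarrow> integral {T..b} (\<lambda>t. norm (dual_emb \<iota> (u' t))) \<le> C"
    using dual_velocity_integrable by blast
  have I: "(\<lambda>t. norm (dual_emb \<iota> (u' t))) integrable_on {a..b}" if "0 \<le> a" for a b
    using that by (intro abs_integrable_imp_integrable integrable_facts)
  obtain S where S: "T \<le> S" "\<And>s t. \<lbrakk>S \<le> s; s \<le> t\<rbrakk> \<Longrightarrow> integral {s..t} (\<lambda>t. norm (dual_emb \<iota> (u' t))) \<le> \<epsilon>"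
    using bounded_integrals_imp_small_tails[OF I[OF T] norm_ge_zero C \<open>0 < \<epsilon>\<close>] by blast
  show ?thesis
  proof (rule that)
    fix s t assume st: "S \<le> s" "s \<le> t"
    have s0: "0 \<le> s" using st S T by simp
    have hi: "((\<lambda>t. dual_emb \<iota> (u' t)) has_integral dual_emb \<iota> (\<iota> (u t) - \<iota> (u s))) {s..t}"
      using has_integral_linear[OF W11_loc_deriv_has_integral[OF u_H s0 st(2)] bounded_linear_dual_emb]
      by (simp add: o_def)
    then have "norm (dual_emb \<iota> (\<iota> (u t) - \<iota> (u s))) \<le> integral {s..t} (\<lambda>t. norm (dual_emb \<iota> (u' t)))"
      using integral_norm_bound_integral[OF has_integral_integrable[OF hi] I[OF s0]]
      by (simp add: integral_unique)
    also have "\<dots> \<le> \<epsilon>" by (rule S(2)[OF st])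
    finally show "norm (dual_emb \<iota> (\<iota> (u t - u s))) \<le> \<epsilon>" by (simp add: blinfun.diff_right)
  qed
qed

section \<open>Decay of the energy to its minimum\<close>

text \<open>After time \<open>S\<close> the energy can rise only by what the remaining source
  allows, at most \<open>\<epsilon> / 2\<close>. Its integral is bounded, so it reaches
  \<open>\<epsilon> / 2\<close> at some later time, and stays below \<open>\<epsilon>\<close> from
  then on.\<close>

lemma potential_tendsto_min:
  assumes \<epsilon>: "0 < \<epsilon>"
  obtains S where "\<And>t. S \<le> t \<Longrightarrow> \<Phi> (u t) - \<Phi> z \<le> \<epsilon>"
proof -
  obtain M where M: "\<And>t. T \<le> t \<Longrightarrow> q t * norm (u' t) \<le> M"
    using weighted_velocity_bounded by blast
  have M0: "0 \<le> M"
    using M[of T] q_nonneg[OF T] by (auto intro: order_trans[rotated])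
  obtain C where C: "\<And>b. T \<le> b \<Longrightarrow> integral {T..b} (\<lambda>t. q t * (norm (u' t))\<^sup>2) \<le> C"
    "\<And>b. T \<le> b \<Longrightarrow> integral {T..b} (\<lambda>t. q t * gap t) \<le> C"
    using weighted_integrals_bounded by blast
  define \<eta> where "\<eta> = \<epsilon> / 2 / (M + 1)"
  have "0 < \<eta>" using \<epsilon> M0 by (simp add: \<eta>_def)
  have \<eta>_le: "M * \<eta> \<le> \<epsilon> / 2"
    using \<epsilon> M0 by (simp add: \<eta>_def field_simps)
  have "\<And>b. (\<lambda>t. q t * norm (g t)) integrable_on {T..b}" "\<And>t. T \<le> t \<Longrightarrow> 0 \<le> q t * norm (g t)"
    using T by (auto intro: abs_integrable_imp_integrable[OF qg_int_on] simp: q_nonneg)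
  then obtain S where S: "T \<le> S" "\<And>s t. \<lbrakk>S \<le> s; s \<le> t\<rbrakk> \<Longrightarrow> integral {s..t} (\<lambda>t. q t * norm (g t)) \<le> \<eta>"
    using bounded_integrals_imp_small_tails[OF _ _ weighted_source_le_mass[OF T] \<open>0 < \<eta>\<close>] by blast
  have energy_le: "energy t \<le> energy s + \<epsilon> / 2" if st: "S \<le> s" "s \<le> t" for s t
  proof -
    have s0: "0 \<le> s" using st S T by simp
    have "energy t - energy s \<le> integral {s..t} (\<lambda>t. norm (u' t) * norm (g t) - \<gamma> t * (norm (u' t))\<^sup>2)"
      using energy_increment[OF s0 st(2)] by (simp add: energy_def)
    \<comment> \<open>The damping term is dropped, and \<open>q \<ge> 1\<close> is used twice: to
      bound the speed by \<open>M\<close> and to put the weight on the source.\<close>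
    also have "\<dots> \<le> integral {s..t} (\<lambda>t. M * (q t * norm (g t)))"
    proof (rule integral_le)
      fix \<tau> assume \<tau>: "\<tau> \<in> {s..t}"
      then have \<tau>0: "0 \<le> \<tau>" "T \<le> \<tau>" using s0 st S by auto
      have "norm (u' \<tau>) \<le> q \<tau> * norm (u' \<tau>)"
        using q_ge_1[OF \<tau>0(1)] by (simp add: mult_le_cancel_right1)
      also have "\<dots> \<le> M" by (rule M[OF \<tau>0(2)])
      finally have "norm (u' \<tau>) * norm (g \<tau>) \<le> M * norm (g \<tau>)"
        by (rule mult_right_mono) simp
      also have "\<dots> \<le> M * (q \<tau> * norm (g \<tau>))"
        using q_ge_1[OF \<tau>0(1)] M0 by (intro mult_left_mono) (auto simp: mult_le_cancel_right1)
      finally show "norm (u' \<tau>) * norm (g \<tau>) - \<gamma> \<tau> * (norm (u' \<tau>))\<^sup>2 \<le> M * (q \<tau> * norm (g \<tau>))"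
        using mult_nonneg_nonneg[OF gamma_nonneg[OF \<tau>0(1)] zero_le_power2[of "norm (u' \<tau>)"]] by linarith
    qed (intro integrable_on_mult_right abs_integrable_imp_integrable[OF qg_int_on]
        abs_integrable_imp_integrable[OF energy_rate_integrable] s0)+
    also have "\<dots> \<le> M * \<eta>"
      using S(2)[OF st] M0 by (simp add: mult_left_mono)
    finally show ?thesis using \<eta>_le by linarith
  qed
  have "\<exists>s\<ge>S. energy s \<le> \<epsilon> / 2"
  proof (rule ccontr)
    assume "\<not> ?thesis"
    then have large: "\<And>s. S \<le> s \<Longrightarrow> \<epsilon> / 2 \<le> energy s" by (meson linear)
    \<comment> \<open>Long enough that an energy of at least \<open>\<epsilon> / 2\<close>
      throughout would integrate to at least \<open>2 * \<bar>C\<bar> + 1\<close>, beyond the bound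
      \<open>C + C\<close>.\<close>
    define b where "b = S + (2 * \<bar>C\<bar> + 1) / (\<epsilon> / 2)"
    have b: "S \<le> b" using \<epsilon> by (simp add: b_def)
    then have bT: "T \<le> b" using S by simp
    have S0: "0 \<le> S" using S T by simp
    have I: "energy integrable_on {S..b}" "(\<lambda>t. q t * (norm (u' t))\<^sup>2) integrable_on {a..b}"
      "(\<lambda>t. q t * gap t) integrable_on {a..b}" if "0 \<le> a" for a
      by (intro abs_integrable_imp_integrable integrable_facts S0 that)+
    have "2 * \<bar>C\<bar> + 1 = integral {S..b} (\<lambda>_. \<epsilon> / 2)"
      using b \<epsilon> by (simp add: b_def)
    also have "\<dots> \<le> integral {S..b} energy"
      using large I(1)[OF T] by (intro integral_le) auto
    also have "\<dots> \<le> integral {S..b} (\<lambda>t. q t * (norm (u' t))\<^sup>2 + q t * gap t)"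
    proof (rule integral_le[OF I(1)[OF T] integrable_add[OF I(2,3)[OF S0]]])
      fix t assume "t \<in> {S..b}"
      then have t0: "0 \<le> t" using S0 by simp
      have "energy t \<le> (norm (u' t))\<^sup>2 + gap t"
        unfolding energy_def using Phi_le_gap[of t] zero_le_power2[of "norm (u' t)"] by linarith
      also have "\<dots> \<le> q t * ((norm (u' t))\<^sup>2 + gap t)"
        using mult_right_mono[OF q_ge_1[OF t0], of "(norm (u' t))\<^sup>2 + gap t"] gap_nonneg[of t] by simp
      finally show "energy t \<le> q t * (norm (u' t))\<^sup>2 + q t * gap t" by (simp add: distrib_left)
    qed
    also have "\<dots> \<le> integral {T..b} (\<lambda>t. q t * (norm (u' t))\<^sup>2 + q t * gap t)"
      using S T I S0 q_nonneg gap_nonneg by (intro integral_subset_le integrable_add) auto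
    also have "\<dots> \<le> C + C"
      unfolding integral_add[OF I(2,3)[OF T]] using C bT by (intro add_mono) auto
    finally show False by linarith
  qed
  then obtain s where s: "S \<le> s" "energy s \<le> \<epsilon> / 2" by blast
  show ?thesis
  proof (rule that)
    fix t assume "s \<le> t"
    then have "energy t \<le> \<epsilon>" using energy_le[OF s(1)] s(2) by force
    then show "\<Phi> (u t) - \<Phi> z \<le> \<epsilon>"
      unfolding energy_def using zero_le_power2[of "norm (u' t)"] by linarith
  qed
qed

end

subsection \<open>Strong convergence\<close>

text \<open>The factor \<open>c\<close> allows two uses: \<open>c = 1\<close> for \<open>q\<close>
  and \<open>c = \<alpha>\<close> for \<open>q'\<close>.\<close>

lemma one_plus_powr_has_derivative:
  assumes "0 \<le> t"
  shows "((\<lambda>t. c * (1 + t) powr \<beta>) has_real_derivative c * \<beta> * (1 + t) powr (\<beta> - 1)) (at t)"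
  using assms by (auto intro!: derivative_eq_intros)

text \<open>Expanding \<open>A (y - v) (y - v) \<ge> 0\<close> gives the tangent inequality of the
  quadratic part; the convexity of \<open>F\<close> supplies the rest.\<close>

lemma potential_above_tangent:
  fixes A :: "'v::real_normed_vector \<Rightarrow>\<^sub>L ('v \<Rightarrow>\<^sub>L real)"
  assumes A_sym: "\<And>v y. A v y = A y v" and A_pos: "\<And>v. 0 \<le> A v v"
    and F: "convex_on UNIV F" and D: "\<And>v. (F has_derivative blinfun_apply (f v)) (at v)"
  shows "potential A F v + (A v + f v) (y - v) \<le> potential A F y"
proof -
  have "0 \<le> A (y - v) (y - v)" by (rule A_pos)
  then have "1/2 * A v v + A v (y - v) \<le> 1/2 * A y y"
    using A_sym[of y v] by (simp add: blinfun.diff_right blinfun.diff_left algebra_simps)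
  then show ?thesis
    using convex_on_has_derivative_above_tangent[OF F D, of v y]
    by (simp add: potential_def blinfun.add_left)
qed

text \<open>At the midpoint \<open>c\<close> the parallelogram identity produces the deficit
  \<open>A (v - y) (v - y)\<close>, which is limited because the potential at \<open>c\<close>
  cannot drop below \<open>m\<close>. Two nearly minimal points are therefore close for the form
  \<open>A\<close>.\<close>

lemma potential_midpoint:
  fixes A :: "'v::real_normed_vector \<Rightarrow>\<^sub>L ('v \<Rightarrow>\<^sub>L real)"
  assumes A_sym: "\<And>v y. A v y = A y v" and F: "convex_on UNIV F"
    and min: "\<And>x. m \<le> potential A F x"
  shows "A (v - y) (v - y) \<le> 4 * ((potential A F v - m) + (potential A F y - m))"
proof -
  define c where "c = (1/2) *\<^sub>R v + (1/2) *\<^sub>R y"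
  have "2 * F c \<le> F v + F y"
    using convex_onD[OF F, of "1/2" v y] by (simp add: c_def)
  moreover have "4 * A c c = 2 * A v v + 2 * A y y - A (v - y) (v - y)"
    using A_sym[of y v]
    by (simp add: c_def blinfun.diff_right blinfun.diff_left blinfun.add_right blinfun.add_left
        blinfun.scaleR_right blinfun.scaleR_left add_divide_distrib)
  moreover have "2 * potential A F x = A x x + 2 * F x" for x
    by (simp add: potential_def)
  note this[of c] this[of v] this[of y]
  ultimately have "8 * potential A F c \<le> 4 * potential A F v + 4 * potential A F y - A (v - y) (v - y)"
    by linarith
  then show ?thesis using min[of c] by simp
qed

theorem theorem1p4:
  fixes \<iota> :: "'v::{real_inner,banach} \<Rightarrow>\<^sub>L 'h::{real_inner,banach}"
    and \<alpha> K t\<^sub>0 l \<mu> :: real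
    and \<gamma> :: "real \<Rightarrow> real"
    and A :: "'v \<Rightarrow>\<^sub>L ('v \<Rightarrow>\<^sub>L real)"
    and f :: "'v \<Rightarrow> ('v \<Rightarrow>\<^sub>L real)"
    and F :: "'v \<Rightarrow> real"
    and g :: "real \<Rightarrow> 'h"
    and u :: "real \<Rightarrow> 'v"
    and u' u'' :: "real \<Rightarrow> 'h"
  assumes embedding_inj: "inj (blinfun_apply \<iota>)"
    and embedding_dense: "closure (range (blinfun_apply \<iota>)) = UNIV"
    and alpha: "0 \<le> \<alpha>" "\<alpha> < 1"
    and gamma_W11: "W11_loc \<gamma>"
    and gamma_nonneg: "\<And>t. 0 \<le> t \<Longrightarrow> 0 \<le> \<gamma> t"
    and K: "0 < K" and t0: "0 \<le> t\<^sub>0"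
    and gamma_lower: "\<And>t. t\<^sub>0 \<le> t \<Longrightarrow> K / (1 + t) powr \<alpha> \<le> \<gamma> t"
    and gamma_deriv: "\<exists>d. W11_loc_deriv (\<lambda>t. (1 + t) powr \<alpha> * \<gamma> t) d \<and>
                          (AE t in lebesgue_on {t\<^sub>0..}. d t \<le> 0)"
    and A_sym: "\<And>v w. A v w = A w v"
    and A_pos: "\<And>v. 0 \<le> A v v"
    and l: "0 \<le> l" and mu: "0 < \<mu>"
    and A_coercive: "\<And>v. \<mu> * (norm v)\<^sup>2 \<le> A v v + l * (norm (\<iota> v))\<^sup>2"
    and f_cont: "continuous_on UNIV f"
    and F_convex: "convex_on UNIV F"
    and F_deriv: "\<And>v. (F has_derivative blinfun_apply (f v)) (at v)"
    and g_L1: "L1_on {0..} g"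
    and argmin_interior: "interior (argmin_set (potential A F)) \<noteq> {}"
    and u_W11_V: "W11_loc u"
    and u_W11_H: "W11_loc_deriv (\<lambda>t. \<iota> (u t)) u'"
    and u'_W11_H: "W11_loc_deriv u' u''"
    and equation: "AE t in lebesgue_on {0..}.
           dual_emb \<iota> (u'' t) + \<gamma> t *\<^sub>R dual_emb \<iota> (u' t) + A (u t) + f (u t) = dual_emb \<iota> (g t)"
    and g_weighted: "integrable (lebesgue_on {0..}) (\<lambda>t. (1 + t) powr \<alpha> * norm (g t))"
    and u_bounded: "Linfty_on {0..} (\<lambda>t. \<iota> (u t))"
  shows "\<exists>v \<in> argmin_set (potential A F). (u \<longlongrightarrow> v) at_top"
proof -
  define \<Phi> where "\<Phi> = potential A F"
  define q where "q t = (1 + t) powr \<alpha>" for t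
  define q' where "q' t = \<alpha> * (1 + t) powr (\<alpha> - 1)" for t
  define q'' where "q'' t = \<alpha> * (\<alpha> - 1) * (1 + t) powr (\<alpha> - 2)" for t
  obtain d\<gamma> where d\<gamma>: "W11_loc_deriv \<gamma> d\<gamma>"
    using gamma_W11 by (auto simp: W11_loc_def)
  obtain w where w: "W11_loc_deriv u w"
    using u_W11_V by (auto simp: W11_loc_def)
  obtain z r where r: "0 < r" and ball: "cball z r \<subseteq> argmin_set \<Phi>"
    using argmin_interior by (auto simp: \<Phi>_def mem_interior_cball)
  obtain C where "AE t in lebesgue_on {0..}. norm (\<iota> (u t)) \<le> C"
    using u_bounded by (auto simp: Linfty_on_def)
  \<comment> \<open>Continuity in \<open>H\<close> upgrades the essential bound to every
    time.\<close>
  then have C: "norm (\<iota> (u t)) \<le> C" if "0 \<le> t" for t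
    using W11_loc_deriv_continuous[OF u_W11_H] that by (intro AE_bounded_continuous_imp_bounded)
  \<comment> \<open>The exponent \<open>\<alpha> - 1\<close> is negative; the resulting
    \<open>T0\<close> is the time after which the weight grows slowly enough.\<close>
  have "(q' \<longlongrightarrow> \<alpha> * 0) at_top"
    unfolding q'_def using alpha
    by (intro tendsto_intros tendsto_neg_powr filterlim_tendsto_add_at_top[OF tendsto_const filterlim_ident]) auto
  then have "\<forall>\<^sub>F t in at_top. q' t < K / 6"
    by (rule order_tendstoD) (use K in simp)
  then obtain T0 where T0: "\<And>t. T0 \<le> t \<Longrightarrow> q' t < K / 6"
    by (auto simp: eventually_at_top_linorder)
  have antimono: "q t * \<gamma> t \<le> q s * \<gamma> s" if st: "t\<^sub>0 \<le> s" "s \<le> t" for s t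
  proof -
    obtain d where d: "W11_loc_deriv (\<lambda>t. q t * \<gamma> t) d" "AE t in lebesgue_on {t\<^sub>0..}. d t \<le> 0"
      using gamma_deriv by (auto simp: q_def)
    obtain N where N: "negligible N" "\<And>t. t \<in> {t\<^sub>0..} - N \<Longrightarrow> d t \<le> 0"
      using AE_lebesgue_on_imp_negligible[OF d(2)] by auto
    have hi: "(d has_integral (q t * \<gamma> t - q s * \<gamma> s)) {s..t}"
      using W11_loc_deriv_has_integral[OF d(1), of s t] st t0 by simp
    have "integral {s..t} d \<le> integral {s..t} (\<lambda>_. 0)"
      using N st by (intro integral_le_off_negligible[OF has_integral_integrable[OF hi] _ N(1)]) auto
    then show ?thesis using integral_unique[OF hi] by simp
  qed
  have F_cont: "continuous_on UNIV F"
    using F_deriv by (intro continuous_at_imp_continuous_on) (blast intro: has_derivative_continuous)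
  \<comment> \<open>The starting time respects both \<open>t\<^sub>0\<close> and \<open>T0\<close>;
    the radius is enlarged by \<open>norm (\<iota> z)\<close> because it bounds
    \<open>u - z\<close>.\<close>
  interpret weighted_flow \<iota> "\<lambda>v. A v + f v" \<Phi> \<gamma> g u w u' u'' q q' q'' "max t\<^sub>0 T0" K "C + norm (\<iota> z)" r z
  proof unfold_locales
    fix a b :: real assume a: "0 \<le> a"
    show "continuous_on {a..b} \<gamma>" by (rule W11_loc_deriv_continuous[OF d\<gamma> a])
    show "continuous_on {a..b} q''"
      unfolding q''_def using a by (intro continuous_intros) auto
  next
    show "continuous_on UNIV (\<lambda>v. A v + f v)"
      by (intro continuous_intros f_cont)
    show "continuous_on UNIV \<Phi>"
      unfolding \<Phi>_def potential_def by (intro continuous_intros F_cont)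
    show "(\<lambda>t. norm (g t)) absolutely_integrable_on {0..}"
      using g_L1 by (intro L1_on_norm_integrable) auto
    show "AE t in lebesgue_on {0..}.
           dual_emb \<iota> (u'' t) + \<gamma> t *\<^sub>R dual_emb \<iota> (u' t) + (A (u t) + f (u t)) = dual_emb \<iota> (g t)"
      using equation by (simp add: add.assoc)
    show "(\<lambda>t. q t * norm (g t)) absolutely_integrable_on {0..}"
      using integrable_on_lebesgue_on[OF g_weighted]
      by (intro nonnegative_absolutely_integrable_1) (auto simp: q_def)
    show "\<Phi> v + (A v + f v) (y - v) \<le> \<Phi> y" for v y
      unfolding \<Phi>_def by (rule potential_above_tangent[OF A_sym A_pos F_convex F_deriv])
    show "0 \<le> max t\<^sub>0 T0" using t0 by simp
    show "0 \<le> t \<Longrightarrow> norm (\<iota> (u t - z)) \<le> C + norm (\<iota> z)" for t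
      using C[of t] norm_triangle_ineq4[of "\<iota> (u t)" "\<iota> z"] by (simp add: blinfun.diff_right)
    show "norm y \<le> r \<Longrightarrow> \<Phi> (z + y) \<le> \<Phi> x" for x y
      using ball by (auto simp: argmin_set_iff subset_iff dist_norm)
    show "max t\<^sub>0 T0 \<le> t \<Longrightarrow> q' t \<le> K / 6" for t
      using T0[of t] by simp
    show "max t\<^sub>0 T0 \<le> t \<Longrightarrow> K \<le> q t * \<gamma> t" for t
      using gamma_lower[of t] t0 by (simp add: q_def field_simps)
    show "\<lbrakk>max t\<^sub>0 T0 \<le> s; s \<le> t\<rbrakk> \<Longrightarrow> q t * \<gamma> t \<le> q s * \<gamma> s" for s t
      using antimono[of s t] by simp
    show "0 \<le> t \<Longrightarrow> 1 \<le> q t" for t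
      unfolding q_def using alpha by (simp add: ge_one_powr_ge_zero)
    show "0 \<le> t \<Longrightarrow> (q has_real_derivative q' t) (at t)" for t
      unfolding q_def q'_def using one_plus_powr_has_derivative[of t 1 \<alpha>] by simp
    show "0 \<le> t \<Longrightarrow> (q' has_real_derivative q'' t) (at t)" for t
      unfolding q'_def q''_def using one_plus_powr_has_derivative[of t \<alpha> "\<alpha> - 1"] by simp
    show "0 \<le> t \<Longrightarrow> 0 \<le> q' t" for t
      using alpha by (simp add: q'_def)
    show "0 \<le> t \<Longrightarrow> q'' t \<le> 0" for t
      using alpha by (simp add: q''_def mult_nonneg_nonpos mult_nonpos_nonneg)
  qed (fact gamma_nonneg w u_W11_H u'_W11_H K r)+
  have "\<exists>S. \<forall>s t. S \<le> s \<longrightarrow> s \<le> t \<longrightarrow> norm (u t - u s) \<le> e" if e: "0 < e" for e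
  proof -
    \<comment> \<open>The two constants let each term of the coercivity inequality take half of
      \<open>\<mu> * (norm x)\<^sup>2\<close>: \<open>l * \<eta>\<close> is at most
      \<open>\<mu> * e / 2\<close>, and \<open>8 * \<epsilon>\<close> equals
      \<open>\<mu> * e\<^sup>2 / 2\<close>. Adding 1 to \<open>l\<close> covers the case
      \<open>l = 0\<close>.\<close>
    define \<eta> where "\<eta> = \<mu> * e / (2 * (l + 1))"
    define \<epsilon> where "\<epsilon> = \<mu> * e\<^sup>2 / 16"
    have pos: "0 < \<eta>" "0 < \<epsilon>" using e mu l by (auto simp: \<eta>_def \<epsilon>_def)
    have l\<eta>: "l * \<eta> \<le> \<mu> * e / 2" using e mu l by (simp add: \<eta>_def field_simps)
    obtain S1 where S1: "\<And>s t. \<lbrakk>S1 \<le> s; s \<le> t\<rbrakk> \<Longrightarrow> norm (dual_emb \<iota> (\<iota> (u t - u s))) \<le> \<eta>"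
      using dual_Cauchy[OF pos(1)] by blast
    obtain S2 where S2: "\<And>t. S2 \<le> t \<Longrightarrow> \<Phi> (u t) - \<Phi> z \<le> \<epsilon>"
      using potential_tendsto_min[OF pos(2)] by blast
    have "norm (u t - u s) \<le> e" if st: "max S1 S2 \<le> s" "s \<le> t" for s t
    proof (rule ccontr)
      define x where "x = u t - u s"
      assume "\<not> norm (u t - u s) \<le> e"
      \<comment> \<open>The negated claim lets factors \<open>e\<close> be replaced by
        \<open>norm x\<close>, making both halves comparable with \<open>(norm x)\<^sup>2\<close>
        and one of them strict.\<close>
      then have x: "e < norm x" by (simp add: x_def)
      have "(norm (\<iota> x))\<^sup>2 = dual_emb \<iota> (\<iota> x) x"
        by (simp add: dual_emb_apply power2_norm_eq_inner)
      also have "\<dots> \<le> norm (dual_emb \<iota> (\<iota> x)) * norm x"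
        using norm_blinfun[of "dual_emb \<iota> (\<iota> x)" x] by simp
      also have "\<dots> \<le> \<eta> * norm x"
        using S1[of s t] st by (intro mult_right_mono) (auto simp: x_def)
      finally have "l * (norm (\<iota> x))\<^sup>2 \<le> l * \<eta> * norm x"
        using l by (simp add: mult_left_mono mult.assoc)
      also have "\<dots> \<le> \<mu> * e / 2 * norm x"
        by (intro mult_right_mono l\<eta>) auto
      also have "\<dots> < \<mu> * norm x / 2 * norm x"
        using x e mu by (intro mult_strict_right_mono) auto
      finally have 1: "l * (norm (\<iota> x))\<^sup>2 < \<mu> * (norm x)\<^sup>2 / 2"
        by (simp add: power2_eq_square)
      have "A x x \<le> 4 * ((\<Phi> (u t) - \<Phi> z) + (\<Phi> (u s) - \<Phi> z))"
        unfolding x_def \<Phi>_def using Phi_min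
        by (intro potential_midpoint A_sym F_convex) (simp add: \<Phi>_def)
      also have "\<dots> \<le> 4 * (\<epsilon> + \<epsilon>)"
        using S2[of s] S2[of t] st by simp
      also have "\<dots> = \<mu> * e\<^sup>2 / 2" by (simp add: \<epsilon>_def)
      also have "\<dots> \<le> \<mu> * (norm x)\<^sup>2 / 2"
        using x e mu by (simp add: power_mono)
      finally show False using 1 A_coercive[of x] by simp
    qed
    then show ?thesis by blast
  qed
  then obtain v where v: "(u \<longlongrightarrow> v) at_top"
    using convergent_at_top_if_Cauchy by blast
  \<comment> \<open>The potential along the trajectory is eventually within any \<open>e\<close> of
    its minimum, and continuity of \<open>\<Phi>\<close> passes this to the limit.\<close>
  have "\<Phi> v \<le> \<Phi> z"
  proof (rule field_le_epsilon)
    fix e :: real assume "0 < e"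
    then obtain S where S: "\<And>t. S \<le> t \<Longrightarrow> \<Phi> (u t) - \<Phi> z \<le> e"
      using potential_tendsto_min by blast
    have "((\<lambda>t. \<Phi> (u t)) \<longlongrightarrow> \<Phi> v) at_top"
      using Phi_cont v by (auto simp: continuous_on_eq_continuous_at intro: isCont_tendsto_compose)
    then show "\<Phi> v \<le> \<Phi> z + e"
      using S by (intro tendsto_upperbound[OF _ _ trivial_limit_at_top_linorder])
        (auto simp: eventually_at_top_linorder algebra_simps)
  qed
  then have "v \<in> argmin_set \<Phi>"
    using Phi_min order_trans by (auto simp: argmin_set_iff)
  with v show ?thesis unfolding \<Phi>_def by blast
qed

end
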